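(* Let $n\geq 1$ and let $k$ be a domain. Let $\mathbf{w}\in\Gamma^n$, let $F=(f_1,\ldots,f_n)\in\mathrm{Aut}_k\,k[\mathbf{x}]$ and let $\emptyset\neq I\subset\{1,\ldots,n\}$. Let $J$ be the set of $1\leq j\leq n$ such that $f_j\in k[\{x_i\mid i\in I\}]$, and let $I_0$ be the set of $i_0\in I$ such that $\deg_{\mathbf{w}}f_j\in\sum_{i\in I\setminus\{i_0\}}\mathbb{Z}_{\geq 0}w_i$ for every $j\in J$ (so $I_0=I$ if $J=\emptyset$). Then the following assertions hold. (i) At least one of (a), (b) holds: (a) There exists a bijection $\sigma:J\to I$ such that $\deg_{\mathbf{w}}f_j=w_{\sigma(j)}$ for each $j\in J$. (b) We have $\sum_{j\in J}\deg_{\mathbf{w}}f_j>\sum_{i\in I}w_i$ or $\#I>\#J$; moreover, for each $\mathbf{v}\in\Gamma^n$, there exists $i\in I_0$ such that $x_i$ does not divide $(f_j^{\mathbf{w}})^{\mathbf{v}}$ for any $j\in J$. (ii) Assume that $\#I>\#J$. Then, for each nonzero $f\in k[\{f_j\mid j\in J\}]$ and each $\mathbf{v}\in\Gamma^n$, there exists $i\in I_0$ such that $x_i$ does not divide $(f^{\mathbf{w}})^{\mathbf{v}}$.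
   Context: $k[\mathbf{x}]=k[x_1,\ldots,x_n]$ is the polynomial ring in $n$ variables over $k$, and $\mathrm{Aut}_k\,k[\mathbf{x}]$ is the group of $k$-algebra automorphisms; $F=(f_1,\ldots,f_n)$ means $f_i=F(x_i)$. $\Gamma$ is a totally ordered additive group, i.e. an additive (abelian) group with a total ordering such that $\alpha\leq\beta$ implies $\alpha+\gamma\leq\beta+\gamma$. For $\mathbf{w}=(w_1,\ldots,w_n)\in\Gamma^n$ and $\gamma\in\Gamma$, let $k[\mathbf{x}]_\gamma$ be the $k$-span of the monomials $x_1^{a_1}\cdots x_n^{a_n}$ with $\sum_i a_iw_i=\gamma$. For $f\neq 0$, written $f=\sum_\gamma f_\gamma$ with $f_\gamma\in k[\mathbf{x}]_\gamma$, the $\mathbf{w}$-degree is $\deg_{\mathbf{w}}f=\max\{\gamma\mid f_\gamma\neq 0\}$ and the $\mathbf{w}$-initial form is $f^{\mathbf{w}}=f_\delta$ with $\delta=\deg_{\mathbf{w}}f$; also $0^{\mathbf{w}}=0$ and $\deg_{\mathbf{w}}0=-\infty$. For elements $d_i\in\Gamma$, $\sum_{i}\mathbb{Z}_{\geq 0}d_i$ denotes the set of all sums $\sum_i a_id_i$ with $a_i\in\mathbb{Z}_{\geq 0}$; an empty sum of this kind is $\{0\}$. *)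

theory Defs
  imports "HOL-Library.Poly_Mapping" "HOL-Library.Extended"
begin

text \<open>
  The polynomial ring \<open>k[x\<^sub>1, \<dots>, x\<^sub>n]\<close>: the finite type \<open>'n\<close> plays the role of the index set
  \<open>{1, \<dots>, n}\<close>; exponent vectors are finitely supported functions \<open>'n \<Rightarrow> nat\<close>, and a polynomial
  is a finitely supported function from exponent vectors to coefficients. The ring operations
  are those of \<^theory>\<open>HOL-Library.Poly_Mapping\<close>.
\<close>

type_synonym ('n, 'k) mpoly = "('n \<Rightarrow>\<^sub>0 nat) \<Rightarrow>\<^sub>0 'k"

definition Const :: "'k::comm_ring_1 \<Rightarrow> ('n, 'k) mpoly" where
  "Const c = Poly_Mapping.single 0 c"

definition Var :: "'n \<Rightarrow> ('n, 'k::comm_ring_1) mpoly" where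
  "Var i = Poly_Mapping.single (Poly_Mapping.single i 1) 1"

definition alg_auts :: "(('n, 'k::comm_ring_1) mpoly \<Rightarrow> ('n, 'k) mpoly) set" where
  "alg_auts = {F. bij F \<and> (\<forall>c. F (Const c) = Const c) \<and>
     (\<forall>p q. F (p + q) = F p + F q) \<and> (\<forall>p q. F (p * q) = F p * F q)}"

text \<open>The \<open>k\<close>-subalgebra \<open>k[S]\<close> generated by a set \<open>S\<close>; in particular \<open>k[{}] = k\<close>.\<close>

inductive_set adjoin :: "('n, 'k::comm_ring_1) mpoly set \<Rightarrow> ('n, 'k) mpoly set"
  for S :: "('n, 'k) mpoly set" where
  const: "Const c \<in> adjoin S"
| gen: "p \<in> S \<Longrightarrow> p \<in> adjoin S"
| add: "p \<in> adjoin S \<Longrightarrow> q \<in> adjoin S \<Longrightarrow> p + q \<in> adjoin S"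
| mult: "p \<in> adjoin S \<Longrightarrow> q \<in> adjoin S \<Longrightarrow> p * q \<in> adjoin S"

text \<open>The multiple \<open>a \<cdot> g = g + \<dots> + g\<close> (\<open>a\<close> summands) in an additive group.\<close>

definition nmult :: "nat \<Rightarrow> 'g::comm_monoid_add \<Rightarrow> 'g" where
  "nmult a g = (\<Sum>_<a. g)"

definition nonneg_span :: "('n::finite \<Rightarrow> 'g::comm_monoid_add) \<Rightarrow> 'n set \<Rightarrow> 'g set" where
  "nonneg_span d A = {(\<Sum>i\<in>A. nmult (a i) (d i)) | a :: 'n \<Rightarrow> nat. True}"

definition mon_weight :: "('n::finite \<Rightarrow> 'g::comm_monoid_add) \<Rightarrow> ('n \<Rightarrow>\<^sub>0 nat) \<Rightarrow> 'g" where
  "mon_weight w m = (\<Sum>i\<in>UNIV. nmult (Poly_Mapping.lookup m i) (w i))"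

text \<open>The component \<open>f\<^sub>\<gamma>\<close> of \<open>f\<close> in the span of the monomials of weight \<open>\<gamma>\<close>.\<close>

definition wcomp ::
  "('n::finite \<Rightarrow> 'g::comm_monoid_add) \<Rightarrow> 'g \<Rightarrow> ('n, 'k::comm_ring_1) mpoly \<Rightarrow> ('n, 'k) mpoly" where
  "wcomp w \<gamma> f = (\<Sum>m | m \<in> Poly_Mapping.keys f \<and> mon_weight w m = \<gamma>.
     Poly_Mapping.single m (Poly_Mapping.lookup f m))"

text \<open>The degree takes values in \<open>\<Gamma>\<close> extended by \<open>-\<infinity>\<close>, which is attained at \<open>0\<close> only; the
  value \<open>\<infinity>\<close> of the type \<open>'g extended\<close> is never attained.\<close>

definition wdeg ::
  "('n::finite \<Rightarrow> 'g::linordered_ab_group_add) \<Rightarrow> ('n, 'k::comm_ring_1) mpoly \<Rightarrow> 'g extended" where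
  "wdeg w f = (if f = 0 then Minf else Fin (Max {\<gamma>. wcomp w \<gamma> f \<noteq> 0}))"

definition init_form ::
  "('n::finite \<Rightarrow> 'g::linordered_ab_group_add) \<Rightarrow> ('n, 'k::comm_ring_1) mpoly \<Rightarrow> ('n, 'k) mpoly" where
  "init_form w f = (if f = 0 then 0 else wcomp w (Max {\<gamma>. wcomp w \<gamma> f \<noteq> 0}) f)"

text \<open>The maximum above is over a finite nonempty set.\<close>

lemma lookup_wcomp:
  "Poly_Mapping.lookup (wcomp w \<gamma> f) m = (if mon_weight w m = \<gamma> then Poly_Mapping.lookup f m else 0)"
proof -
  have "Poly_Mapping.lookup (wcomp w \<gamma> f) m =
      (\<Sum>l | l \<in> Poly_Mapping.keys f \<and> mon_weight w l = \<gamma>. if l = m then Poly_Mapping.lookup f l else 0)"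
    by (simp add: wcomp_def Poly_Mapping.lookup_sum Poly_Mapping.lookup_single when_def)
  also have "\<dots> = (if mon_weight w m = \<gamma> then Poly_Mapping.lookup f m else 0)"
    by (auto simp: sum.delta Poly_Mapping.in_keys_iff)
  finally show ?thesis .
qed

lemma wcomp_nonzero_set: "{\<gamma>. wcomp w \<gamma> f \<noteq> 0} = mon_weight w ` Poly_Mapping.keys f"
  by (auto simp: poly_mapping_eq_iff fun_eq_iff lookup_wcomp Poly_Mapping.in_keys_iff image_iff)

lemma finite_wcomp_nonzero: "finite {\<gamma>. wcomp w \<gamma> f \<noteq> 0}"
  by (simp add: wcomp_nonzero_set)

lemma wcomp_nonzero_nonempty: "f \<noteq> 0 \<Longrightarrow> {\<gamma>. wcomp w \<gamma> f \<noteq> 0} \<noteq> {}"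
  by (simp add: wcomp_nonzero_set)

end

theory Submission
  imports Defs "HOL-Computational_Algebra.Polynomial" "HOL-Analysis.Determinants"
begin

text \<open>
  Put \<open>h(p) = (p\<^sup>w)\<^sup>v\<close>. This is the initial form of \<open>p\<close> for the lexicographic weight \<open>(w, v)\<close>
  (\<open>init_form_lex\<close>), so most of the argument works with one weight \<open>u\<close> in an arbitrary totally ordered
  group. The set \<open>I\<^sub>0\<close> also disappears: if \<open>i \<in> I\<close> and \<open>x\<^sub>i\<close> divides no \<open>h(f\<^sub>j)\<close> with \<open>j \<in> J\<close>, then \<open>i \<in> I\<^sub>0\<close>
  (\<open>wdeg_in_nonneg_span\<close>). What has to be found are variables that do not divide given initial forms.

  The tool is the homomorphism \<open>\<phi>\<^sub>l : k[x] \<rightarrow> k[x][T]\<close> that sends \<open>f\<^sub>l\<close> to \<open>f\<^sub>l + T\<close> and fixes the other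
  coordinates. It replaces the derivation \<open>\<partial>/\<partial>f\<^sub>l\<close> in a way that does not depend on the
  characteristic. With \<open>y\<^sub>i = \<phi>\<^sub>l(x\<^sub>i)\<close> one has \<open>p(y) = \<phi>\<^sub>l(p)\<close> and \<open>y\<^sub>i = x\<^sub>i\<close> at \<open>T = 0\<close>. Suppose that \<open>\<phi>\<^sub>l\<close>
  moves some variable in \<open>I\<close>. Then \<open>T\<close> can be given a weight for which no \<open>y\<^sub>i\<close> with \<open>i \<in> I\<close> exceeds the
  weight of \<open>x\<^sub>i\<close>, while for some \<open>i \<in> I\<close> the top part \<open>Y\<^sub>i\<close> of \<open>y\<^sub>i\<close> involves \<open>T\<close> (\<open>exists_weight_of_T\<close>). For
  \<open>p \<in> k[x\<^sub>I]\<close> the top part of \<open>p(y)\<close> is \<open>h(p)(Y)\<close> (\<open>pcomp_evalp\<close>). If \<open>h(p) = x\<^sub>i g\<close>, then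
  \<open>Y\<^sub>i g(Y)\<close> is the top part of \<open>\<phi>\<^sub>l(p)\<close>. This is impossible when \<open>\<phi>\<^sub>l(p) = p\<close>, because the factor \<open>Y\<^sub>i\<close>
  involves \<open>T\<close> and the product does not. When \<open>\<phi>\<^sub>l(p) = p + T\<close>, the product must be \<open>h(p) + T\<close>, so \<open>g\<close>
  is a constant and \<open>deg p\<close> is the weight of \<open>x\<^sub>i\<close> (\<open>Var_dvd_top_component_imp\<close>).

  The sizes of \<open>I\<close> and \<open>J\<close> enter through the Jacobian matrix of the \<open>f\<^sub>j\<close> at the origin. It is
  invertible, and its inverse consists of the coefficients of \<open>T\<close> in the \<open>\<phi>\<^sub>l(x\<^sub>i)\<close> at the origin
  (\<open>chain_rule_at_origin\<close>). Nonzero terms of the two determinants give permutations \<open>\<pi>\<close> and \<open>\<rho>\<close> such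
  that \<open>x\<^bsub>\<pi>(j)\<^esub>\<close> occurs linearly in \<open>f\<^sub>j\<close> and \<open>\<phi>\<^bsub>\<rho>(i)\<^esub>\<close> moves \<open>x\<^sub>i\<close> (\<open>aut_matchings\<close>). In particular
  \<open>\<pi>\<close> embeds \<open>J\<close> into \<open>I\<close>.

  If \<open>#I > #J\<close>, then \<open>\<rho>(i) \<notin> J\<close> for some \<open>i \<in> I\<close>. The corresponding \<open>\<phi>\<^sub>l\<close> fixes \<open>k[f\<^sub>j | j \<in> J]\<close>, and applying
  the above to the product of \<open>p\<close> and all \<open>f\<^sub>j\<close> yields (ii) and (b).

  If \<open>#I = #J\<close>, then \<open>\<pi>\<close> is a bijection from \<open>J\<close> to \<open>I\<close>. As \<open>deg\<^sub>w f\<^sub>j \<ge> w\<^bsub>\<pi>(j)\<^esub>\<close>, the inequality of sums holds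
  unless all these are equalities, which is case (a). Suppose moreover that every \<open>x\<^sub>i\<close> with \<open>i \<in> I\<close>
  divides some \<open>h(f\<^sub>j)\<close>. For \<open>l \<in> J\<close> the homomorphism \<open>\<phi>\<^sub>l\<close> moves \<open>f\<^sub>l \<in> k[x\<^sub>I]\<close>, which singles out an \<open>i \<in> I\<close>
  such that \<open>x\<^sub>i\<close> divides no \<open>h(f\<^sub>j)\<close> with \<open>j \<noteq> l\<close>. So it divides \<open>h(f\<^sub>l)\<close> and \<open>deg\<^sub>w f\<^sub>l = w\<^sub>i\<close>. Different
  \<open>l\<close> give different \<open>i\<close>, and this is again case (a).
\<close>

hide_const (open) Poly_Mapping.degree

section \<open>Weights and top components\<close>

lemma nmult_0 [simp]: "nmult 0 g = 0"
  by (simp add: nmult_def)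

lemma nmult_Suc [simp]: "nmult (Suc a) g = g + nmult a g"
  by (simp add: nmult_def add.commute)

lemma nmult_add: "nmult (a + b) g = nmult a g + nmult b g"
  by (induction a) (simp_all add: add.assoc)

lemma nmult_zero_right [simp]: "nmult a 0 = 0"
  by (induction a) simp_all

lemma nmult_add_right: "nmult a (g + h) = nmult a g + nmult a h"
  by (induction a) (simp_all add: ac_simps)

lemma nmult_sum_right: "nmult a (sum g A) = (\<Sum>i\<in>A. nmult a (g i))"
  by (induction A rule: infinite_finite_induct) (simp_all add: nmult_add_right)

lemma nmult_mult: "nmult (a * b) g = nmult a (nmult b g)"
  by (induction a) (simp_all add: nmult_add)

lemma nmult_strict_mono: "0 < a \<Longrightarrow> g < h \<Longrightarrow> nmult a g < nmult a h"
  for g :: "'g::linordered_ab_group_add"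
proof (induction a)
  case (Suc a)
  then show ?case by (cases a) (auto intro: add_strict_mono)
qed simp

lemma nmult_le_iff: "0 < a \<Longrightarrow> nmult a g \<le> nmult a h \<longleftrightarrow> g \<le> h"
  for g :: "'g::linordered_ab_group_add"
  by (metis nmult_strict_mono linorder_not_less order_less_le)

lemma nmult_eq_iff: "0 < a \<Longrightarrow> nmult a g = nmult a h \<longleftrightarrow> g = h"
  for g :: "'g::linordered_ab_group_add"
  by (metis nmult_le_iff order_antisym order_refl)

lemma nmult_diff_right: "nmult a (g - h) = nmult a g - nmult a h"
  for g :: "'g::ab_group_add"
  by (induction a) (simp_all add: algebra_simps)

lemma mon_weight_0 [simp]: "mon_weight w 0 = 0"
  by (simp add: mon_weight_def)

lemma mon_weight_add: "mon_weight w (a + b) = mon_weight w a + mon_weight w b"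
  by (simp add: mon_weight_def lookup_add nmult_add sum.distrib)

lemma mon_weight_single [simp]: "mon_weight w (Poly_Mapping.single i a) = nmult a (w i)"
proof -
  have "mon_weight w (Poly_Mapping.single i a) = (\<Sum>j\<in>UNIV. if j = i then nmult a (w j) else 0)"
    unfolding mon_weight_def by (rule sum.cong) (auto simp: lookup_single when_def)
  then show ?thesis by simp
qed

lemma mon_weight_nmult: "mon_weight (\<lambda>i. nmult N (w i)) m = nmult N (mon_weight w m)"
  unfolding mon_weight_def nmult_sum_right
  by (rule sum.cong) (simp_all flip: nmult_mult add: mult.commute)

lemma keys_nonempty: "p \<noteq> 0 \<Longrightarrow> \<exists>m. m \<in> Poly_Mapping.keys p"
  by (metis in_keys_iff lookup_zero poly_mapping_eqI)

lemma wcomp_0 [simp]: "wcomp w \<gamma> 0 = 0"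
  by (simp add: wcomp_def)

lemma wcomp_add: "wcomp w \<gamma> (p + q) = wcomp w \<gamma> p + wcomp w \<gamma> q"
  by (rule poly_mapping_eqI) (simp add: lookup_wcomp lookup_add)

lemma wcomp_sum: "wcomp w \<gamma> (sum p A) = (\<Sum>x\<in>A. wcomp w \<gamma> (p x))"
  by (induction A rule: infinite_finite_induct) (simp_all add: wcomp_add)

lemma wcomp_single:
  "wcomp w \<gamma> (Poly_Mapping.single m c) = (if mon_weight w m = \<gamma> then Poly_Mapping.single m c else 0)"
  by (rule poly_mapping_eqI) (auto simp: lookup_wcomp lookup_single when_def)

lemma keys_wcomp: "Poly_Mapping.keys (wcomp w \<gamma> p) = {m \<in> Poly_Mapping.keys p. mon_weight w m = \<gamma>}"
  by (auto simp: in_keys_iff lookup_wcomp split: if_splits)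

text \<open>
  The initial form is handled through the pair \<open>wbound w \<gamma> p\<close>, \<open>wcomp w \<gamma> p\<close>. Unlike the maximum in
  the definition of the degree, this pair is compatible with sums and products even when the
  component of weight \<open>\<gamma>\<close> vanishes; for \<open>wcomp w \<gamma> p \<noteq> 0\<close> it is the initial form.
\<close>

definition wbound ::
  "('n::finite \<Rightarrow> 'g::linordered_ab_group_add) \<Rightarrow> 'g \<Rightarrow> ('n, 'k::comm_ring_1) mpoly \<Rightarrow> bool" where
  "wbound w \<gamma> p \<longleftrightarrow> (\<forall>m\<in>Poly_Mapping.keys p. mon_weight w m \<le> \<gamma>)"

lemma wbound_0 [simp]: "wbound w \<gamma> 0"
  by (simp add: wbound_def)

lemma wbound_add: "wbound w \<gamma> p \<Longrightarrow> wbound w \<gamma> q \<Longrightarrow> wbound w \<gamma> (p + q)"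
  using keys_add[of p q] by (auto simp: wbound_def)

lemma wbound_sum: "(\<And>x. x \<in> A \<Longrightarrow> wbound w \<gamma> (p x)) \<Longrightarrow> wbound w \<gamma> (sum p A)"
  by (induction A rule: infinite_finite_induct) (simp_all add: wbound_add)

lemma wbound_mult:
  assumes "wbound w \<gamma> p" "wbound w \<delta> q"
  shows "wbound w (\<gamma> + \<delta>) (p * q)"
  using assms keys_mult[of p q] by (fastforce simp: wbound_def mon_weight_add intro: add_mono)

text \<open>
  A part of \<open>p\<close> or \<open>q\<close> of weight below the bound contributes to the product only below \<open>\<gamma> + \<delta>\<close>.
\<close>

lemma wcomp_mult:
  assumes p: "wbound w \<gamma> p" and q: "wbound w \<delta> q"
  shows "wcomp w (\<gamma> + \<delta>) (p * q) = wcomp w \<gamma> p * wcomp w \<delta> q"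
proof -
  define p' where "p' = p - wcomp w \<gamma> p"
  define q' where "q' = q - wcomp w \<delta> q"
  have p'_less: "mon_weight w m < \<gamma>" if "m \<in> Poly_Mapping.keys p'" for m
    using that p by (fastforce simp: p'_def in_keys_iff lookup_minus lookup_wcomp wbound_def order_less_le split: if_splits)
  have q'_less: "mon_weight w m < \<delta>" if "m \<in> Poly_Mapping.keys q'" for m
    using that q by (fastforce simp: q'_def in_keys_iff lookup_minus lookup_wcomp wbound_def order_less_le split: if_splits)
  have split: "p * q = wcomp w \<gamma> p * wcomp w \<delta> q + (wcomp w \<gamma> p * q' + p' * q)"
    by (simp add: p'_def q'_def algebra_simps)
  have 1: "wcomp w (\<gamma> + \<delta>) (wcomp w \<gamma> p * wcomp w \<delta> q) = wcomp w \<gamma> p * wcomp w \<delta> q"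
    (is "wcomp w _ ?r = _")
  proof (rule poly_mapping_eqI)
    fix m
    have "mon_weight w m = \<gamma> + \<delta>" if "m \<in> Poly_Mapping.keys ?r"
      using keys_mult[of "wcomp w \<gamma> p" "wcomp w \<delta> q"] that by (auto simp: keys_wcomp mon_weight_add)
    then show "Poly_Mapping.lookup (wcomp w (\<gamma> + \<delta>) ?r) m = Poly_Mapping.lookup ?r m"
      by (auto simp: lookup_wcomp in_keys_iff)
  qed
  have 2: "wcomp w (\<gamma> + \<delta>) (wcomp w \<gamma> p * q') = 0"
  proof -
    have "mon_weight w m < \<gamma> + \<delta>" if "m \<in> Poly_Mapping.keys (wcomp w \<gamma> p * q')" for m
      using keys_mult[of "wcomp w \<gamma> p" q'] that q'_less
      by (auto simp: keys_wcomp mon_weight_add)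
    then show ?thesis
      by (intro poly_mapping_eqI) (force simp: lookup_wcomp in_keys_iff)
  qed
  have 3: "wcomp w (\<gamma> + \<delta>) (p' * q) = 0"
  proof -
    have "mon_weight w m < \<gamma> + \<delta>" if "m \<in> Poly_Mapping.keys (p' * q)" for m
      using keys_mult[of p' q] that p'_less q
      by (fastforce simp: keys_wcomp mon_weight_add wbound_def intro: add_less_le_mono)
    then show ?thesis
      by (intro poly_mapping_eqI) (force simp: lookup_wcomp in_keys_iff)
  qed
  show ?thesis
    unfolding split by (simp add: wcomp_add 1 2 3)
qed

lemma obtain_top:
  fixes p :: "('n::finite, 'k::comm_ring_1) mpoly"
  assumes "p \<noteq> 0"
  obtains \<gamma> where "wbound w \<gamma> p" "wcomp w \<gamma> p \<noteq> 0"
proof -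
  let ?S = "{\<gamma>. wcomp w \<gamma> p \<noteq> 0}"
  have "Max ?S \<in> ?S"
    using Max_in[OF finite_wcomp_nonzero wcomp_nonzero_nonempty[OF assms]] .
  moreover have "wbound w (Max ?S) p"
    using Max_ge[OF finite_wcomp_nonzero, of _ w p] by (simp add: wbound_def wcomp_nonzero_set)
  ultimately show thesis using that by blast
qed

lemma top_unique:
  assumes "wbound w \<gamma> p" "wcomp w \<gamma> p \<noteq> 0"
  shows "wdeg w p = Fin \<gamma>" "init_form w p = wcomp w \<gamma> p"
proof -
  have "Max {\<gamma>. wcomp w \<gamma> p \<noteq> 0} = \<gamma>"
  proof (rule Max_eqI[OF finite_wcomp_nonzero])
    show "\<delta> \<le> \<gamma>" if "\<delta> \<in> {\<gamma>. wcomp w \<gamma> p \<noteq> 0}" for \<delta>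
      using that assms(1) by (auto simp: wcomp_nonzero_set wbound_def)
  qed (use assms(2) in simp)
  then show "wdeg w p = Fin \<gamma>" "init_form w p = wcomp w \<gamma> p"
    using assms(2) by (auto simp: wdeg_def init_form_def)
qed

text \<open>
  In a weight that separates monomials the top component of a nonzero polynomial is a single term,
  and a product of two nonzero terms is nonzero. Such a weight is \<open>x\<^sub>i \<mapsto>\<close> the unit vector at \<open>e i\<close> in
  \<open>nat \<Rightarrow>\<^sub>0 int\<close>, ordered lexicographically, where \<open>e\<close> numbers the variables: the weight of a monomial
  is then its exponent vector.
\<close>

lemma mpoly_no_zero_divisors:
  fixes p q :: "('n::finite, 'k::idom) mpoly"
  assumes "p \<noteq> 0" "q \<noteq> 0"
  shows "p * q \<noteq> 0"
proof -
  obtain e :: "'n \<Rightarrow> nat" where e: "inj e"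
    using finite_imp_inj_to_nat_seg[of "UNIV :: 'n set"] by auto
  define w :: "'n \<Rightarrow> nat \<Rightarrow>\<^sub>0 int" where "w i = Poly_Mapping.single (e i) 1" for i
  have nm: "nmult a (Poly_Mapping.single l (1::int)) = Poly_Mapping.single l (int a)" for a and l :: nat
    by (induction a) (simp_all flip: single_add)
  have lookup: "Poly_Mapping.lookup (mon_weight w m) (e i) = int (Poly_Mapping.lookup m i)" for m i
    using e by (simp add: mon_weight_def w_def nm lookup_sum lookup_single when_def inj_eq)
  have inj: "m = m'" if "mon_weight w m = mon_weight w m'" for m m'
    by (rule poly_mapping_eqI) (metis lookup that of_nat_eq_iff)
  have mono: "\<exists>m c. c \<noteq> 0 \<and> wcomp w \<gamma> r = Poly_Mapping.single m c" if nz: "wcomp w \<gamma> r \<noteq> 0"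
    for \<gamma> and r :: "('n, 'k) mpoly"
  proof -
    obtain m where m: "m \<in> Poly_Mapping.keys (wcomp w \<gamma> r)"
      using keys_nonempty[OF nz] by blast
    have "wcomp w \<gamma> r = Poly_Mapping.single m (Poly_Mapping.lookup r m)"
      using m inj[of _ m] by (intro poly_mapping_eqI) (auto simp: keys_wcomp lookup_wcomp lookup_single when_def)
    moreover have "Poly_Mapping.lookup r m \<noteq> 0"
      using m by (auto simp: keys_wcomp)
    ultimately show ?thesis by blast
  qed
  obtain \<gamma> where \<gamma>: "wbound w \<gamma> p" "wcomp w \<gamma> p \<noteq> 0"
    using obtain_top[OF assms(1)] .
  obtain \<delta> where \<delta>: "wbound w \<delta> q" "wcomp w \<delta> q \<noteq> 0"
    using obtain_top[OF assms(2)] .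
  obtain a c b d where "c \<noteq> 0" "d \<noteq> 0"
    "wcomp w \<gamma> p = Poly_Mapping.single a c" "wcomp w \<delta> q = Poly_Mapping.single b d"
    using mono[OF \<gamma>(2)] mono[OF \<delta>(2)] by blast
  then have "Poly_Mapping.lookup (wcomp w (\<gamma> + \<delta>) (p * q)) (a + b) \<noteq> 0"
    by (simp add: wcomp_mult[OF \<gamma>(1) \<delta>(1)] mult_single)
  then show ?thesis by auto
qed

lemma init_form_mult:
  fixes p q :: "('n::finite, 'k::idom) mpoly"
  assumes "p \<noteq> 0" "q \<noteq> 0"
  shows "init_form w (p * q) = init_form w p * init_form w q"
proof -
  obtain \<gamma> where \<gamma>: "wbound w \<gamma> p" "wcomp w \<gamma> p \<noteq> 0"
    using obtain_top[OF assms(1)] .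
  obtain \<delta> where \<delta>: "wbound w \<delta> q" "wcomp w \<delta> q \<noteq> 0"
    using obtain_top[OF assms(2)] .
  have "wcomp w (\<gamma> + \<delta>) (p * q) \<noteq> 0"
    using \<gamma> \<delta> by (simp add: wcomp_mult mpoly_no_zero_divisors)
  from top_unique(2)[OF wbound_mult[OF \<gamma>(1) \<delta>(1)] this]
  show ?thesis
    using \<gamma> \<delta> by (simp add: top_unique[OF \<gamma>] top_unique[OF \<delta>] wcomp_mult)
qed

text \<open>
  Total degrees are nonnegative and add up in a product, so the two factors have total degree zero.
\<close>

lemma dvd_Const_imp_constant:
  fixes p q :: "('n::finite, 'k::idom) mpoly"
  assumes pq: "p * q = Const b" and "b \<noteq> 0"
  shows "Poly_Mapping.keys p \<subseteq> {0}"
proof -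
  let ?w = "\<lambda>_::'n. 1 :: int"
  have nm: "nmult a (1::int) = int a" for a
    by (induction a) simp_all
  have weight: "mon_weight ?w m = int (\<Sum>i\<in>UNIV. Poly_Mapping.lookup m i)" for m
    by (simp add: mon_weight_def nm)
  have nz: "p \<noteq> 0" "q \<noteq> 0"
    using assms by (auto simp: Const_def dest: arg_cong[of _ _ "\<lambda>r. Poly_Mapping.lookup r 0"])
  obtain \<gamma> where \<gamma>: "wbound ?w \<gamma> p" "wcomp ?w \<gamma> p \<noteq> 0"
    using obtain_top[OF nz(1)] .
  obtain \<delta> where \<delta>: "wbound ?w \<delta> q" "wcomp ?w \<delta> q \<noteq> 0"
    using obtain_top[OF nz(2)] .
  have "\<delta> \<ge> 0"
    using keys_nonempty[OF \<delta>(2)] by (auto simp: keys_wcomp weight intro!: sum_nonneg)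
  moreover have "wcomp ?w (\<gamma> + \<delta>) (Const b :: ('n, 'k) mpoly) \<noteq> 0"
    using \<gamma> \<delta> by (simp add: pq[symmetric] wcomp_mult mpoly_no_zero_divisors)
  then have "\<gamma> + \<delta> = 0"
    by (auto simp: Const_def wcomp_single split: if_splits)
  ultimately have "\<gamma> \<le> 0" by simp
  show ?thesis
  proof
    fix m assume "m \<in> Poly_Mapping.keys p"
    then have "mon_weight ?w m \<le> 0"
      using \<gamma>(1) \<open>\<gamma> \<le> 0\<close> by (force simp: wbound_def)
    then have "(\<Sum>i\<in>UNIV. Poly_Mapping.lookup m i) = 0"
      unfolding weight by linarith
    then have "m = 0"
      by (intro poly_mapping_eqI) simp
    then show "m \<in> {0}" by simp
  qed
qed

section \<open>Substitution of polynomials in an additional variable\<close>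

lemma Const_0 [simp]: "Const 0 = 0" and Const_1 [simp]: "Const 1 = 1"
  by (simp_all add: Const_def)

lemma Const_add: "Const (a + b) = Const a + Const b"
  by (simp add: Const_def single_add)

lemma Const_mult: "Const (a * b) = Const a * Const b"
  by (simp add: Const_def mult_single)

lemma sum_singles: "p = (\<Sum>m\<in>Poly_Mapping.keys p. Poly_Mapping.single m (Poly_Mapping.lookup p m))"
  by (rule poly_mapping_eqI) (simp add: lookup_sum lookup_single when_def sum.delta in_keys_iff)

lemma mpoly_induct [case_names zero single add]:
  fixes p :: "('n, 'k::comm_ring_1) mpoly"
  assumes "P 0" "\<And>m c. P (Poly_Mapping.single m c)" "\<And>p q. P p \<Longrightarrow> P q \<Longrightarrow> P (p + q)"
  shows "P p"
proof -
  have "P (\<Sum>m\<in>A. Poly_Mapping.single m (Poly_Mapping.lookup p m))" for A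
    by (induction A rule: infinite_finite_induct) (use assms in auto)
  from this[of "Poly_Mapping.keys p"] show ?thesis by (simp flip: sum_singles)
qed

text \<open>
  Links the representation of monomials as exponent vectors with the variables; it is what makes
  the variables generate the whole ring.
\<close>

lemma single_eq_prod_Var:
  "Poly_Mapping.single m c = Const c * (\<Prod>i\<in>UNIV. Var i ^ Poly_Mapping.lookup m i)"
  for m :: "'n::finite \<Rightarrow>\<^sub>0 nat"
proof -
  have pow: "Var i ^ a = Poly_Mapping.single (Poly_Mapping.single i a) 1" for i :: 'n and a
    by (induction a) (simp_all add: Var_def mult_single flip: single_add)
  have prod: "(\<Prod>i\<in>A. Poly_Mapping.single (h i) 1) = Poly_Mapping.single (\<Sum>i\<in>A. h i) 1"
    for A :: "'n set" and h :: "'n \<Rightarrow> 'n \<Rightarrow>\<^sub>0 nat"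
    by (induction A rule: infinite_finite_induct) (simp_all add: mult_single)
  have "(\<Sum>i\<in>UNIV. Poly_Mapping.single i (Poly_Mapping.lookup m i)) = m"
    by (rule poly_mapping_eqI) (simp add: lookup_sum lookup_single when_def)
  then show ?thesis
    by (simp add: pow prod Const_def mult_single)
qed

lemma adjoin_prod: "(\<And>i. i \<in> A \<Longrightarrow> p i \<in> adjoin S) \<Longrightarrow> prod p A \<in> adjoin S"
  using adjoin.const[of 1 S] by (induction A rule: infinite_finite_induct) (auto intro: adjoin.mult)

lemma adjoin_power: "p \<in> adjoin S \<Longrightarrow> p ^ a \<in> adjoin S"
  using adjoin.const[of 1 S] by (induction a) (auto intro: adjoin.mult)

lemma adjoin_range_Var: "p \<in> adjoin (range Var)" for p :: "('n::finite, 'k::comm_ring_1) mpoly"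
proof (induction p rule: mpoly_induct)
  case zero
  show ?case using adjoin.const[of 0 "range Var"] by simp
next
  case (single m c)
  show ?case unfolding single_eq_prod_Var
    by (intro adjoin.mult adjoin.const adjoin_prod adjoin_power adjoin.gen) simp
qed (rule adjoin.add)

lemma keys_adjoin_Var:
  assumes "p \<in> adjoin (Var ` I)" "m \<in> Poly_Mapping.keys p"
  shows "Poly_Mapping.keys m \<subseteq> I"
  using assms
proof (induction arbitrary: m)
  case (const c)
  then show ?case by (auto simp: Const_def split: if_splits)
next
  case (gen p)
  then show ?case by (auto simp: Var_def split: if_splits)
next
  case (add p q)
  then show ?case using keys_add[of p q] by blast
next
  case (mult p q)
  from mult.prems obtain a b where "m = a + b" "a \<in> Poly_Mapping.keys p" "b \<in> Poly_Mapping.keys q"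
    using keys_mult[of p q] by blast
  then show ?case using mult.IH keys_add[of a b] by blast
qed

text \<open>
  The ring \<open>k[x][T]\<close> is modelled by univariate polynomials over \<open>k[x]\<close>; its \<open>k\<close>-algebra structure is
  the one given by constants in both \<open>x\<close> and \<open>T\<close>.
\<close>

definition alg_hom_T :: "(('n, 'k::comm_ring_1) mpoly \<Rightarrow> ('n, 'k) mpoly poly) \<Rightarrow> bool" where
  "alg_hom_T \<phi> \<longleftrightarrow> (\<forall>c. \<phi> (Const c) = [:Const c:]) \<and>
     (\<forall>p q. \<phi> (p + q) = \<phi> p + \<phi> q) \<and> (\<forall>p q. \<phi> (p * q) = \<phi> p * \<phi> q)"

lemma alg_hom_TD:
  assumes "alg_hom_T \<phi>"
  shows "\<phi> (Const c) = [:Const c:]" "\<phi> (p + q) = \<phi> p + \<phi> q" "\<phi> (p * q) = \<phi> p * \<phi> q"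
  using assms by (auto simp: alg_hom_T_def)

lemma alg_hom_T_eq_on_adjoin:
  assumes "alg_hom_T \<phi>" "alg_hom_T \<psi>" "\<And>s. s \<in> S \<Longrightarrow> \<phi> s = \<psi> s" "p \<in> adjoin S"
  shows "\<phi> p = \<psi> p"
  using assms(4) by induction (simp_all add: alg_hom_TD[OF assms(1)] alg_hom_TD[OF assms(2)] assms(3))

lemma alg_hom_T_inclusion: "alg_hom_T (\<lambda>p. [:p:])"
  by (simp add: alg_hom_T_def)

lemma alg_hom_T_coeff_0: "alg_hom_T \<phi> \<Longrightarrow> alg_hom_T (\<lambda>p. [:coeff (\<phi> p) 0:])"
  by (simp add: alg_hom_T_def coeff_mult_0)

definition evalp ::
  "('n::finite \<Rightarrow> ('n, 'k::comm_ring_1) mpoly poly) \<Rightarrow> ('n, 'k) mpoly \<Rightarrow> ('n, 'k) mpoly poly" where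
  "evalp y p = (\<Sum>m\<in>Poly_Mapping.keys p.
     smult (Const (Poly_Mapping.lookup p m)) (\<Prod>i\<in>UNIV. y i ^ Poly_Mapping.lookup m i))"

lemma evalp_superset:
  assumes "finite A" "Poly_Mapping.keys p \<subseteq> A"
  shows "evalp y p = (\<Sum>m\<in>A.
     smult (Const (Poly_Mapping.lookup p m)) (\<Prod>i\<in>UNIV. y i ^ Poly_Mapping.lookup m i))"
  unfolding evalp_def using assms by (intro sum.mono_neutral_left) (auto simp: in_keys_iff)

lemma evalp_0 [simp]: "evalp y 0 = 0"
  by (simp add: evalp_def)

lemma evalp_add: "evalp y (p + q) = evalp y p + evalp y q"
proof -
  let ?A = "Poly_Mapping.keys p \<union> Poly_Mapping.keys q"
  have A: "finite ?A" by simp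
  have "Poly_Mapping.keys (p + q) \<subseteq> ?A" by (rule keys_add)
  then show ?thesis
    by (simp add: evalp_superset[OF A] lookup_add Const_add smult_add_left sum.distrib)
qed

lemma evalp_sum: "evalp y (sum p A) = (\<Sum>x\<in>A. evalp y (p x))"
  by (induction A rule: infinite_finite_induct) (simp_all add: evalp_add)

lemma evalp_single:
  "evalp y (Poly_Mapping.single m c) = smult (Const c) (\<Prod>i\<in>UNIV. y i ^ Poly_Mapping.lookup m i)"
  by (subst evalp_superset[of "{m}"]) auto

lemma evalp_mult: "evalp y (p * q) = evalp y p * evalp y q"
proof (induction p rule: mpoly_induct)
  case (single m c)
  show ?case
  proof (induction q rule: mpoly_induct)
    case (single n d)
    show ?case
      by (simp add: mult_single evalp_single lookup_add power_add prod.distrib Const_mult mult_ac)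
  qed (simp_all add: evalp_add algebra_simps)
qed (simp_all add: evalp_add algebra_simps)

lemma evalp_Const: "evalp y (Const c) = [:Const c:]"
  using evalp_single[of y 0 c] by (simp flip: Const_def)

lemma evalp_Var [simp]: "evalp y (Var i) = y i"
proof -
  have "(\<Prod>j\<in>UNIV. y j ^ Poly_Mapping.lookup (Poly_Mapping.single i 1) j) = (\<Prod>j\<in>UNIV. if j = i then y j else 1)"
    by (rule prod.cong) (auto simp: lookup_single when_def)
  then show ?thesis
    by (simp add: Var_def evalp_single)
qed

lemma alg_hom_T_evalp: "alg_hom_T (evalp y)"
  by (simp add: alg_hom_T_def evalp_add evalp_mult evalp_Const)

lemma alg_hom_T_eq_evalp:
  fixes \<phi> :: "('n::finite, 'k::comm_ring_1) mpoly \<Rightarrow> ('n, 'k) mpoly poly"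
  assumes "alg_hom_T \<phi>"
  shows "\<phi> p = evalp (\<lambda>i. \<phi> (Var i)) p"
  by (rule alg_hom_T_eq_on_adjoin[OF assms alg_hom_T_evalp _ adjoin_range_Var]) auto

section \<open>Weights of polynomials in the additional variable\<close>

text \<open>
  Weights on \<open>k[x][T]\<close> when \<open>T\<close> has weight \<open>t\<close>: a term \<open>c T\<^sup>d\<close> of weight \<open>\<gamma>\<close> has its coefficient \<open>c\<close> in
  weight \<open>\<gamma> - d t\<close>.
\<close>

definition pbound ::
  "('n::finite \<Rightarrow> 'g::linordered_ab_group_add) \<Rightarrow> 'g \<Rightarrow> 'g \<Rightarrow> ('n, 'k::comm_ring_1) mpoly poly \<Rightarrow> bool" where
  "pbound w t \<gamma> P \<longleftrightarrow> (\<forall>d. wbound w (\<gamma> - nmult d t) (coeff P d))"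

definition pcomp ::
  "('n::finite \<Rightarrow> 'g::linordered_ab_group_add) \<Rightarrow> 'g \<Rightarrow> 'g \<Rightarrow> ('n, 'k::comm_ring_1) mpoly poly \<Rightarrow>
     ('n, 'k) mpoly poly" where
  "pcomp w t \<gamma> P = (\<Sum>d\<le>degree P. monom (wcomp w (\<gamma> - nmult d t) (coeff P d)) d)"

lemma coeff_pcomp [simp]: "coeff (pcomp w t \<gamma> P) d = wcomp w (\<gamma> - nmult d t) (coeff P d)"
  by (auto simp: pcomp_def coeff_sum coeff_eq_0)

lemma pcomp_add: "pcomp w t \<gamma> (P + Q) = pcomp w t \<gamma> P + pcomp w t \<gamma> Q"
  by (rule poly_eqI) (simp add: wcomp_add)

lemma pcomp_0 [simp]: "pcomp w t \<gamma> 0 = 0"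
  by (rule poly_eqI) simp

lemma pcomp_sum: "pcomp w t \<gamma> (sum P A) = (\<Sum>x\<in>A. pcomp w t \<gamma> (P x))"
  by (induction A rule: infinite_finite_induct) (simp_all add: pcomp_add)

lemma pcomp_const_poly: "pcomp w t \<gamma> [:p:] = [:wcomp w \<gamma> p:]"
  by (rule poly_eqI) (simp add: coeff_pCons split: nat.split)

lemma weight_split_T_degree:
  fixes \<gamma> :: "'g::linordered_ab_group_add"
  assumes "i \<le> d"
  shows "\<gamma> + \<delta> - nmult d t = (\<gamma> - nmult i t) + (\<delta> - nmult (d - i) t)"
proof -
  have "nmult d t = nmult i t + nmult (d - i) t"
    using assms by (simp flip: nmult_add)
  then show ?thesis by (simp add: algebra_simps)
qed

lemma pbound_mult:
  assumes "pbound w t \<gamma> P" "pbound w t \<delta> Q"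
  shows "pbound w t (\<gamma> + \<delta>) (P * Q)"
  unfolding pbound_def
proof
  fix d
  show "wbound w (\<gamma> + \<delta> - nmult d t) (coeff (P * Q) d)"
    unfolding coeff_mult
  proof (rule wbound_sum)
    fix i assume "i \<in> {..d}"
    then show "wbound w (\<gamma> + \<delta> - nmult d t) (coeff P i * coeff Q (d - i))"
      using assms by (simp add: weight_split_T_degree pbound_def wbound_mult)
  qed
qed

lemma pcomp_mult:
  assumes "pbound w t \<gamma> P" "pbound w t \<delta> Q"
  shows "pcomp w t (\<gamma> + \<delta>) (P * Q) = pcomp w t \<gamma> P * pcomp w t \<delta> Q"
proof (rule poly_eqI)
  fix d
  have "wcomp w (\<gamma> + \<delta> - nmult d t) (coeff P i * coeff Q (d - i)) =
      coeff (pcomp w t \<gamma> P) i * coeff (pcomp w t \<delta> Q) (d - i)" if "i \<le> d" for i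
    unfolding weight_split_T_degree[OF that] using assms by (simp add: pbound_def wcomp_mult)
  then show "coeff (pcomp w t (\<gamma> + \<delta>) (P * Q)) d = coeff (pcomp w t \<gamma> P * pcomp w t \<delta> Q) d"
    unfolding coeff_mult coeff_pcomp wcomp_sum by simp
qed

lemma pbound_const: "pbound w t 0 [:Const c:]"
  by (auto simp: pbound_def coeff_pCons wbound_def Const_def split: nat.split if_splits)

lemma pcomp_const: "pcomp w t 0 [:Const c:] = [:Const c:]"
  by (simp add: pcomp_const_poly Const_def wcomp_single)

lemma pbound_1: "pbound w t 0 1" and pcomp_1: "pcomp w t 0 1 = 1"
  using pbound_const[of w t 1] pcomp_const[of w t 1] by (simp_all add: one_pCons)

lemma pcomp_less:
  assumes "pbound w t \<delta> P" "\<delta> < \<gamma>"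
  shows "pcomp w t \<gamma> P = 0"
proof (rule poly_eqI)
  fix d
  have "wbound w (\<delta> - nmult d t) (coeff P d)" "\<delta> - nmult d t < \<gamma> - nmult d t"
    using assms by (auto simp: pbound_def)
  then show "coeff (pcomp w t \<gamma> P) d = coeff 0 d"
    by (intro poly_mapping_eqI) (force simp: lookup_wcomp wbound_def in_keys_iff)
qed

lemma pbound_pcomp_power:
  assumes "pbound w t \<gamma> P"
  shows "pbound w t (nmult a \<gamma>) (P ^ a) \<and> pcomp w t (nmult a \<gamma>) (P ^ a) = pcomp w t \<gamma> P ^ a"
  by (induction a) (use assms in \<open>simp_all add: pbound_1 pcomp_1 pbound_mult pcomp_mult\<close>)

lemma pbound_pcomp_prod:
  assumes "\<And>i. i \<in> A \<Longrightarrow> pbound w t (\<gamma> i) (P i)"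
  shows "pbound w t (sum \<gamma> A) (prod P A) \<and> pcomp w t (sum \<gamma> A) (prod P A) = (\<Prod>i\<in>A. pcomp w t (\<gamma> i) (P i))"
  using assms
  by (induction A rule: infinite_finite_induct) (simp_all add: pbound_1 pcomp_1 pbound_mult pcomp_mult)

text \<open>
  The substitution principle behind the whole argument. If each \<open>y i\<close> is bounded by the weight of
  \<open>x\<^sub>i\<close>, then the substitution \<open>x\<^sub>i \<mapsto> y i\<close> does not raise weights, so the terms of top weight in
  \<open>p(y)\<close> arise only from the top component of \<open>p\<close> and the top parts \<open>Y i\<close>.
\<close>

lemma pcomp_evalp:
  fixes p :: "('n::finite, 'k::comm_ring_1) mpoly"
  assumes vars: "\<And>m. m \<in> Poly_Mapping.keys p \<Longrightarrow> Poly_Mapping.keys m \<subseteq> I"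
    and p: "wbound u \<gamma> p"
    and y: "\<And>i. i \<in> I \<Longrightarrow> pbound u t (u i) (y i)"
    and Y: "\<And>i. i \<in> I \<Longrightarrow> pcomp u t (u i) (y i) = Y i"
  shows "pcomp u t \<gamma> (evalp y p) = evalp Y (wcomp u \<gamma> p)"
proof -
  have monomial: "pcomp u t \<gamma> (evalp y (Poly_Mapping.single m c)) = evalp Y (wcomp u \<gamma> (Poly_Mapping.single m c))"
    if m: "m \<in> Poly_Mapping.keys p" for m c
  proof -
    let ?M = "\<Prod>i\<in>UNIV. y i ^ Poly_Mapping.lookup m i"
    have exp: "Poly_Mapping.lookup m i = 0" if "i \<notin> I" for i
      using vars[OF m] that by (auto simp: in_keys_iff)
    \<comment> \<open>A variable outside \<open>I\<close> has exponent \<open>0\<close>, hence contributes the factor \<open>1\<close> whatever \<open>y i\<close> is.\<close>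
    have pow: "pbound u t (nmult (Poly_Mapping.lookup m i) (u i)) (y i ^ Poly_Mapping.lookup m i) \<and>
        pcomp u t (nmult (Poly_Mapping.lookup m i) (u i)) (y i ^ Poly_Mapping.lookup m i) = Y i ^ Poly_Mapping.lookup m i"
      for i
    proof (cases "i \<in> I")
      case True
      then show ?thesis using pbound_pcomp_power[OF y[OF True]] Y by metis
    next
      case False
      then show ?thesis by (simp add: exp pbound_1 pcomp_1)
    qed
    have M: "pbound u t (mon_weight u m) ?M"
        "pcomp u t (mon_weight u m) ?M = (\<Prod>i\<in>UNIV. Y i ^ Poly_Mapping.lookup m i)"
      unfolding mon_weight_def
      using pbound_pcomp_prod[of UNIV u t "\<lambda>i. nmult (Poly_Mapping.lookup m i) (u i)" "\<lambda>i. y i ^ Poly_Mapping.lookup m i"] pow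
      by simp_all
    have eval: "evalp y (Poly_Mapping.single m c) = [:Const c:] * ?M"
      by (simp add: evalp_single)
    have bound: "pbound u t (mon_weight u m) (evalp y (Poly_Mapping.single m c))"
      using pbound_mult[OF pbound_const M(1)] by (simp add: eval)
    show ?thesis
    proof (cases "mon_weight u m = \<gamma>")
      case True
      then show ?thesis
        using pcomp_mult[OF pbound_const M(1), of c] M(2)
        by (simp add: eval pcomp_const wcomp_single evalp_single)
    next
      case False
      then have "mon_weight u m < \<gamma>"
        using p m by (auto simp: wbound_def)
      then show ?thesis
        using pcomp_less[OF bound] False by (simp add: wcomp_single)
    qed
  qed
  have "pcomp u t \<gamma> (evalp y p) = (\<Sum>m\<in>Poly_Mapping.keys p. pcomp u t \<gamma> (evalp y (Poly_Mapping.single m (Poly_Mapping.lookup p m))))"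
    by (subst sum_singles) (simp add: evalp_sum pcomp_sum)
  also have "\<dots> = evalp Y (wcomp u \<gamma> (\<Sum>m\<in>Poly_Mapping.keys p. Poly_Mapping.single m (Poly_Mapping.lookup p m)))"
    by (simp add: monomial evalp_sum wcomp_sum)
  finally show ?thesis by (simp flip: sum_singles)
qed

section \<open>Initial forms divisible by a moved variable\<close>

text \<open>
  Let \<open>h = x\<^sub>i g\<close> be the top component of \<open>p\<close>. Comparing top parts in \<open>p(y) = p + a T\<close> gives
  \<open>Y\<^sub>i g(Y) = h + e\<close>, where \<open>e\<close> is \<open>a T\<close> or \<open>0\<close>. As \<open>Y\<^sub>i\<close> involves \<open>T\<close> and \<open>k[x][T]\<close> is a domain, the right-hand
  side has positive degree in \<open>T\<close>; so \<open>a \<noteq> 0\<close>, the degree is one, \<open>g(Y)\<close> is free of \<open>T\<close> and therefore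
  equals \<open>g\<close>, and \<open>g\<close> divides the coefficient \<open>a\<close> of \<open>T\<close>. Hence \<open>g\<close> is a constant and \<open>h\<close> is a multiple of
  \<open>x\<^sub>i\<close>, which fixes its weight.
\<close>

lemma Var_dvd_top_component_imp:
  fixes u :: "'n::finite \<Rightarrow> 'h::linordered_ab_group_add" and p :: "('n, 'k::idom) mpoly"
  assumes y0: "\<And>j. coeff (y j) 0 = Var j"
    and y: "\<And>j. j \<in> I \<Longrightarrow> pbound u t (u j) (y j)"
    and i: "i \<in> I" "degree (pcomp u t (u i) (y i)) \<noteq> 0"
    and vars: "\<And>m. m \<in> Poly_Mapping.keys p \<Longrightarrow> Poly_Mapping.keys m \<subseteq> I"
    and p: "wbound u \<gamma> p" "wcomp u \<gamma> p \<noteq> 0"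
    and eval: "evalp y p = [:p, Const a:]"
    and dvd: "Var i dvd wcomp u \<gamma> p"
  shows "a \<noteq> 0" and "\<gamma> = u i"
proof -
  \<comment> \<open>Outside \<open>I\<close> the value is chosen so that setting \<open>T = 0\<close> turns every \<open>Y j\<close> into \<open>x\<^sub>j\<close>.\<close>
  define Y where "Y j = (if j \<in> I then pcomp u t (u j) (y j) else [:Var j:])" for j
  obtain g where g: "wcomp u \<gamma> p = Var i * g"
    using dvd by (auto elim: dvdE)
  let ?e = "wcomp u (\<gamma> - t) (Const a) :: ('n, 'k) mpoly"
  have "pcomp u t \<gamma> (evalp y p) = evalp Y (wcomp u \<gamma> p)"
    by (rule pcomp_evalp[OF vars p(1) y]) (simp_all add: Y_def)
  also have "pcomp u t \<gamma> (evalp y p) = [:wcomp u \<gamma> p, ?e:]"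
    unfolding eval by (rule poly_eqI) (simp add: coeff_pCons split: nat.split)
  also have "evalp Y (wcomp u \<gamma> p) = Y i * evalp Y g"
    by (simp add: g evalp_mult)
  finally have prod: "Y i * evalp Y g = [:wcomp u \<gamma> p, ?e:]" ..
  have "degree (Y i) \<noteq> 0"
    using i by (simp add: Y_def)
  have "evalp Y g \<noteq> 0"
    using prod p(2) by auto
  have "coeff (Y i * evalp Y g) (degree (Y i) + degree (evalp Y g)) \<noteq> 0"
    unfolding coeff_mult_degree_sum
    using \<open>degree (Y i) \<noteq> 0\<close> \<open>evalp Y g \<noteq> 0\<close> by (intro mpoly_no_zero_divisors) auto
  then have "degree (Y i) + degree (evalp Y g) \<le> degree (Y i * evalp Y g)"
    by (rule le_degree)
  also have "\<dots> \<le> 1"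
    by (simp add: prod)
  finally have deg: "degree (Y i) = 1" "degree (evalp Y g) = 0"
    using \<open>degree (Y i) \<noteq> 0\<close> by auto
  have Y0: "coeff (Y j) 0 = Var j" for j
    by (simp add: Y_def y0) (simp add: Var_def wcomp_single)
  have "[:coeff (evalp Y g) 0:] = [:g:]"
    by (rule alg_hom_T_eq_on_adjoin[OF alg_hom_T_coeff_0[OF alg_hom_T_evalp] alg_hom_T_inclusion
          _ adjoin_range_Var]) (auto simp: Y0)
  then have G: "evalp Y g = [:g:]"
    using deg(2) by (metis degree_eq_zeroE coeff_pCons_0 pCons_eq_iff)
  have "coeff (Y i * evalp Y g) 1 = coeff (Y i) 1 * g"
    by (simp add: G mult.commute)
  then have c1: "g * coeff (Y i) 1 = ?e"
    by (simp add: prod mult.commute)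
  have nz: "g \<noteq> 0" "coeff (Y i) 1 \<noteq> 0"
    using p(2) g deg(1) by (auto, metis leading_coeff_0_iff degree_0 zero_neq_one)
  have "?e \<noteq> 0"
    using mpoly_no_zero_divisors[OF nz] c1 by simp
  then have a: "a \<noteq> 0" "?e = Const a"
    by (auto simp: Const_def wcomp_single split: if_splits)
  then show "a \<noteq> 0" by simp
  have "Poly_Mapping.keys g \<subseteq> {0}"
    using dvd_Const_imp_constant c1 a by metis
  then have "g = Poly_Mapping.single 0 (Poly_Mapping.lookup g 0)"
    by (intro poly_mapping_eqI) (auto simp: lookup_single when_def in_keys_iff)
  then have top: "wcomp u \<gamma> p = Poly_Mapping.single (Poly_Mapping.single i 1) (Poly_Mapping.lookup g 0)"
    unfolding g by (metis Var_def mult_single add.right_neutral mult_1)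
  then have "Poly_Mapping.single i 1 \<in> Poly_Mapping.keys (wcomp u \<gamma> p)"
    using p(2) by auto
  then show "\<gamma> = u i"
    unfolding keys_wcomp by simp
qed

text \<open>
  A term \<open>c T\<^sup>d\<close> of \<open>y\<^sub>j\<close> with \<open>d \<ge> 1\<close> respects the bound \<open>u\<^sub>j\<close> iff \<open>d t \<le> u\<^sub>j - weight c\<close>. So the largest
  admissible weight \<open>t\<close> is the minimum of the quotients \<open>(u\<^sub>j - weight c) / d\<close>, and for this \<open>t\<close> some
  term with \<open>d \<ge> 1\<close> reaches the bound. The group need not be divisible, so \<open>u\<close> is first multiplied by
  a common multiple \<open>N\<close> of all the occurring \<open>d\<close>; this changes neither initial forms nor the order
  of weights.
\<close>

lemma exists_weight_of_T:
  fixes u :: "'n::finite \<Rightarrow> 'h::linordered_ab_group_add" and y :: "'n \<Rightarrow> ('n, 'k::comm_ring_1) mpoly poly"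
  assumes y0: "\<And>j. coeff (y j) 0 = Var j" and j: "j \<in> I" "degree (y j) \<noteq> 0"
  obtains N t i where "N > 0" "i \<in> I"
    "\<And>j. j \<in> I \<Longrightarrow> pbound (\<lambda>j. nmult N (u j)) t (nmult N (u j)) (y j)"
    "degree (pcomp (\<lambda>j. nmult N (u j)) t (nmult N (u i)) (y i)) \<noteq> 0"
proof -
  define K where "K = Max (range (\<lambda>j. degree (y j)))"
  have K: "degree (y j) \<le> K" for j
    unfolding K_def by (rule Max_ge) auto
  define N where "N = (fact K :: nat)"
  have "N > 0" by (simp add: N_def)
  have N_div: "N = d * (N div d)" if "0 < d" "d \<le> K" for d
    using that by (simp add: N_def dvd_fact)
  define S where "S = (SIGMA j:I. SIGMA d:{1..K}. Poly_Mapping.keys (coeff (y j) d))"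
  define \<beta> where "\<beta> = (\<lambda>(j, d, m). nmult (N div d) (u j - mon_weight u m))"
  have "finite S"
    unfolding S_def by (intro finite_SigmaI) auto
  have "coeff (y j) (degree (y j)) \<noteq> 0"
    using j(2) by auto
  then obtain m where "m \<in> Poly_Mapping.keys (coeff (y j) (degree (y j)))"
    using keys_nonempty by blast
  then have "(j, degree (y j), m) \<in> S"
    using j K[of j] by (simp add: S_def)
  then have "S \<noteq> {}" by auto
  define t where "t = Min (\<beta> ` S)"
  have slack: "nmult d (\<beta> (j, d, m)) = nmult N (u j) - mon_weight (\<lambda>j. nmult N (u j)) m"
    if "(j, d, m) \<in> S" for j d m
  proof -
    have "nmult d (\<beta> (j, d, m)) = nmult N (u j - mon_weight u m)"
      using that N_div[of d] by (simp add: S_def \<beta>_def flip: nmult_mult)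
    then show ?thesis
      by (simp add: nmult_diff_right mon_weight_nmult)
  qed
  have t_le: "t \<le> \<beta> s" if "s \<in> S" for s
    using that \<open>finite S\<close> by (simp add: t_def)
  have "t \<in> \<beta> ` S"
    unfolding t_def using \<open>finite S\<close> \<open>S \<noteq> {}\<close> by (intro Min_in) auto
  then obtain i d m where s: "(i, d, m) \<in> S" "t = \<beta> (i, d, m)"
    by (metis imageE prod_cases3)
  show thesis
  proof
    show "N > 0" by fact
    show "i \<in> I" using s(1) by (simp add: S_def)
    show "pbound (\<lambda>j. nmult N (u j)) t (nmult N (u j)) (y j)" if j: "j \<in> I" for j
      unfolding pbound_def wbound_def
    proof (intro allI ballI)
      fix d m assume m: "m \<in> Poly_Mapping.keys (coeff (y j) d)"
      show "mon_weight (\<lambda>j. nmult N (u j)) m \<le> nmult N (u j) - nmult d t"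
      proof (cases "d = 0")
        case True
        then have "m = Poly_Mapping.single j 1"
          using m by (simp add: y0 Var_def)
        then show ?thesis using True by simp
      next
        case False
        have "d \<le> K"
          using m K[of j] le_degree[of "y j" d] by force
        then have S: "(j, d, m) \<in> S"
          using False j m by (simp add: S_def)
        have "nmult d t \<le> nmult d (\<beta> (j, d, m))"
          using False t_le[OF S] by (simp add: nmult_le_iff)
        then show ?thesis
          unfolding slack[OF S] by (simp add: algebra_simps)
      qed
    qed
    have "m \<in> Poly_Mapping.keys (coeff (y i) d)" "d \<ge> 1"
      using s(1) by (auto simp: S_def)
    then have "m \<in> Poly_Mapping.keys (coeff (pcomp (\<lambda>j. nmult N (u j)) t (nmult N (u i)) (y i)) d)"
      using slack[OF s(1)] by (simp add: keys_wcomp s(2))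
    then have "coeff (pcomp (\<lambda>j. nmult N (u j)) t (nmult N (u i)) (y i)) d \<noteq> 0"
      by auto
    then show "degree (pcomp (\<lambda>j. nmult N (u j)) t (nmult N (u i)) (y i)) \<noteq> 0"
      using le_degree \<open>d \<ge> 1\<close> by fastforce
  qed
qed

text \<open>
  The two preceding lemmas together, with the factor \<open>N\<close> removed again. The index \<open>i\<close> depends only on
  \<open>y\<close> and \<open>u\<close>, not on \<open>p\<close>: this uniformity is what allows several \<open>f\<^sub>j\<close> to be treated at once.
\<close>

lemma exists_moved_variable:
  fixes u :: "'n::finite \<Rightarrow> 'h::linordered_ab_group_add" and y :: "'n \<Rightarrow> ('n, 'k::idom) mpoly poly"
  assumes y0: "\<And>j. coeff (y j) 0 = Var j" and j: "j \<in> I" "degree (y j) \<noteq> 0"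
  obtains i where "i \<in> I"
    "\<And>p a. p \<noteq> 0 \<Longrightarrow> p \<in> adjoin (Var ` I) \<Longrightarrow> evalp y p = [:p, Const a:] \<Longrightarrow>
       Var i dvd init_form u p \<Longrightarrow> a \<noteq> 0 \<and> wdeg u p = Fin (u i)"
proof -
  obtain N t i where N: "N > 0" and i: "i \<in> I"
    and y: "\<And>j. j \<in> I \<Longrightarrow> pbound (\<lambda>j. nmult N (u j)) t (nmult N (u j)) (y j)"
    and deg: "degree (pcomp (\<lambda>j. nmult N (u j)) t (nmult N (u i)) (y i)) \<noteq> 0"
    by (rule exists_weight_of_T[where u = u, OF y0 j]) blast
  let ?u = "\<lambda>j. nmult N (u j)"
  show thesis
  proof (rule that[OF i])
    fix p :: "('n, 'k) mpoly" and a
    assume p: "p \<noteq> 0" "p \<in> adjoin (Var ` I)" "evalp y p = [:p, Const a:]" "Var i dvd init_form u p"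
    obtain \<gamma> where \<gamma>: "wbound u \<gamma> p" "wcomp u \<gamma> p \<noteq> 0"
      using obtain_top[OF p(1)] .
    have scaled: "wcomp ?u (nmult N \<gamma>) p = wcomp u \<gamma> p"
      by (rule poly_mapping_eqI) (simp add: lookup_wcomp mon_weight_nmult nmult_eq_iff[OF N])
    have bound: "wbound ?u (nmult N \<gamma>) p"
      using \<gamma>(1) by (simp add: wbound_def mon_weight_nmult nmult_le_iff[OF N])
    have dvd: "Var i dvd wcomp ?u (nmult N \<gamma>) p"
      using p(4) by (simp add: scaled top_unique[OF \<gamma>])
    have nz: "wcomp ?u (nmult N \<gamma>) p \<noteq> 0"
      using \<gamma>(2) by (simp add: scaled)
    note concl = Var_dvd_top_component_imp[of y I ?u t i p "nmult N \<gamma>" a,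
        OF y0 y i deg keys_adjoin_Var[OF p(2)] bound nz p(3) dvd]
    have "\<gamma> = u i"
      using concl(2) by (simp add: nmult_eq_iff[OF N])
    then show "a \<noteq> 0 \<and> wdeg u p = Fin (u i)"
      using concl(1) by (simp add: top_unique[OF \<gamma>])
  qed
qed

section \<open>Linear coefficients and point derivations\<close>

lemma exponent_add_eq_0_iff: "a + b = 0 \<longleftrightarrow> a = 0 \<and> b = 0" for a b :: "'n \<Rightarrow>\<^sub>0 nat"
  by (auto simp: poly_mapping_eq_iff fun_eq_iff lookup_add)

lemma exponent_add_eq_single_iff:
  "a + b = Poly_Mapping.single i 1 \<longleftrightarrow>
     a = 0 \<and> b = Poly_Mapping.single i 1 \<or> a = Poly_Mapping.single i 1 \<and> b = 0"
  for a b :: "'n \<Rightarrow>\<^sub>0 nat"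
proof
  assume sum: "a + b = Poly_Mapping.single i 1"
  have eq: "Poly_Mapping.lookup a j + Poly_Mapping.lookup b j = (if j = i then 1 else 0)" for j
    using arg_cong[OF sum, of "\<lambda>m. Poly_Mapping.lookup m j"] by (auto simp: lookup_add lookup_single when_def)
  show "a = 0 \<and> b = Poly_Mapping.single i 1 \<or> a = Poly_Mapping.single i 1 \<and> b = 0"
  proof (cases "Poly_Mapping.lookup a i = 0")
    case True
    then have "a = 0"
      using eq by (intro poly_mapping_eqI) (metis (full_types) add_is_0 lookup_zero)
    then show ?thesis using sum by simp
  next
    case False
    then have "Poly_Mapping.lookup b j = 0" for j
      using eq[of j] by (cases "j = i") auto
    then have "b = 0"
      by (intro poly_mapping_eqI) simp
    then show ?thesis using sum by simp
  qed
qed auto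

lemma lookup_mult_0:
  "Poly_Mapping.lookup (p * q) 0 = Poly_Mapping.lookup p 0 * Poly_Mapping.lookup q 0"
  for p q :: "('n, 'k::comm_ring_1) mpoly"
proof (induction p rule: mpoly_induct)
  case (single m c)
  show ?case
    by (induction q rule: mpoly_induct)
      (auto simp: mult_single lookup_single when_def exponent_add_eq_0_iff lookup_add algebra_simps)
qed (simp_all add: lookup_add algebra_simps)

lemma lookup_mult_single:
  "Poly_Mapping.lookup (p * q) (Poly_Mapping.single i 1) =
     Poly_Mapping.lookup p 0 * Poly_Mapping.lookup q (Poly_Mapping.single i 1) +
     Poly_Mapping.lookup p (Poly_Mapping.single i 1) * Poly_Mapping.lookup q 0"
  for p q :: "('n, 'k::comm_ring_1) mpoly"
proof (induction p rule: mpoly_induct)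
  case (single m c)
  have nz: "Poly_Mapping.single i (1::nat) \<noteq> 0"
    by (metis lookup_single_eq lookup_zero zero_neq_one)
  show ?case
  proof (induction q rule: mpoly_induct)
    case (single n d)
    show ?case
      unfolding mult_single lookup_single when_def exponent_add_eq_single_iff using nz by auto
  qed (simp_all add: lookup_add algebra_simps)
qed (simp_all add: lookup_add algebra_simps)

text \<open>
  A nonzero determinant has a nonzero term in its Leibniz expansion.
\<close>

lemma det_nonzero_imp_matching:
  fixes M :: "'a::idom ^ 'n::finite ^ 'n"
  assumes "det M \<noteq> 0"
  obtains \<pi> where "\<pi> permutes UNIV" "\<And>i. M $ i $ \<pi> i \<noteq> 0"
proof -
  have "\<exists>\<pi>\<in>{\<pi>. \<pi> permutes UNIV}. of_int (sign \<pi>) * (\<Prod>i\<in>UNIV. M $ i $ \<pi> i) \<noteq> 0"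
    using assms unfolding det_def by (rule contrapos_np) (simp add: sum.neutral)
  then obtain \<pi> where \<pi>: "\<pi> permutes (UNIV :: 'n set)"
    "of_int (sign \<pi>) * (\<Prod>i\<in>UNIV. M $ i $ \<pi> i) \<noteq> 0"
    by blast
  from \<pi>(2) have "M $ i $ \<pi> i \<noteq> 0" for i
    by auto
  with \<pi>(1) show thesis by (rule that)
qed

section \<open>Translations of one coordinate\<close>

text \<open>
  The homomorphism \<open>k[x] \<rightarrow> k[x][T]\<close> that sends the coordinate \<open>f\<^sub>l = F(x\<^sub>l)\<close> to \<open>f\<^sub>l + T\<close> and fixes the
  other coordinates. In characteristic zero it is the exponential of \<open>T\<close> times the derivation
  \<open>\<partial>/\<partial>f\<^sub>l\<close>; as a homomorphism it makes sense in every characteristic.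
\<close>

definition shift_coord ::
  "(('n::finite, 'k::comm_ring_1) mpoly \<Rightarrow> ('n, 'k) mpoly) \<Rightarrow> 'n \<Rightarrow> ('n, 'k) mpoly \<Rightarrow> ('n, 'k) mpoly poly" where
  "shift_coord F l p = evalp (\<lambda>j. [:F (Var j), Const (if j = l then 1 else 0):]) (inv F p)"

lemma alg_autsD:
  assumes "F \<in> alg_auts"
  shows "bij F" "F (Const c) = Const c" "F (p + q) = F p + F q" "F (p * q) = F p * F q"
  using assms by (auto simp: alg_auts_def)

lemma inv_aut [simp]:
  assumes "F \<in> alg_auts"
  shows "inv F (F p) = p" "F (inv F p) = p"
  using alg_autsD(1)[OF assms] by (simp_all add: bij_is_inj bij_is_surj surj_f_inv_f)

lemma alg_hom_T_shift_coord:
  assumes "F \<in> alg_auts"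
  shows "alg_hom_T (shift_coord F l)"
proof -
  have "inv F (Const c) = Const c" for c
    using inv_aut(1)[OF assms, of "Const c"] by (simp add: alg_autsD(2)[OF assms])
  moreover have "inv F (p + q) = inv F p + inv F q" for p q
    using inv_aut(1)[OF assms, of "inv F p + inv F q"]
    by (simp add: alg_autsD(3)[OF assms] inv_aut(2)[OF assms])
  moreover have "inv F (p * q) = inv F p * inv F q" for p q
    using inv_aut(1)[OF assms, of "inv F p * inv F q"]
    by (simp add: alg_autsD(4)[OF assms] inv_aut(2)[OF assms])
  ultimately show ?thesis
    by (simp add: alg_hom_T_def shift_coord_def evalp_Const evalp_add evalp_mult)
qed

lemma shift_coord_coord:
  "F \<in> alg_auts \<Longrightarrow> shift_coord F l (F (Var j)) = [:F (Var j), Const (if j = l then 1 else 0):]"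
  by (simp add: shift_coord_def)

lemma adjoin_coords:
  fixes F :: "('n::finite, 'k::comm_ring_1) mpoly \<Rightarrow> ('n, 'k) mpoly"
  assumes "F \<in> alg_auts"
  shows "p \<in> adjoin (range (\<lambda>j. F (Var j)))"
proof -
  have "F q \<in> adjoin (range (\<lambda>j. F (Var j)))" for q
    using adjoin_range_Var[of q]
    by induction (auto simp: alg_autsD[OF assms] intro: adjoin.intros)
  from this[of "inv F p"] show ?thesis
    using assms by simp
qed

lemma coeff_0_shift_coord:
  assumes "F \<in> alg_auts"
  shows "coeff (shift_coord F l p) 0 = p"
proof -
  have "[:coeff (shift_coord F l p) 0:] = [:p:]"
    by (rule alg_hom_T_eq_on_adjoin[OF alg_hom_T_coeff_0[OF alg_hom_T_shift_coord[OF assms]]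
          alg_hom_T_inclusion _ adjoin_coords[OF assms]]) (auto simp: shift_coord_coord[OF assms])
  then show ?thesis by simp
qed

lemma shift_coord_eq_evalp:
  "F \<in> alg_auts \<Longrightarrow> shift_coord F l p = evalp (\<lambda>i. shift_coord F l (Var i)) p"
  by (rule alg_hom_T_eq_evalp[OF alg_hom_T_shift_coord])

text \<open>
  The chain rule \<open>\<partial>p/\<partial>x\<^sub>m = \<Sum>\<^sub>l (\<partial>p/\<partial>f\<^sub>l) (\<partial>f\<^sub>l/\<partial>x\<^sub>m)\<close> at the origin, where \<open>\<partial>p/\<partial>f\<^sub>l\<close> is the coefficient of \<open>T\<close>
  in the image of \<open>p\<close> under \<open>shift_coord F l\<close>. Both sides are point derivations at the origin, so it
  suffices that they agree on the generators \<open>f\<^sub>j\<close>.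
\<close>

lemma chain_rule_at_origin:
  fixes F :: "('n::finite, 'k::comm_ring_1) mpoly \<Rightarrow> ('n, 'k) mpoly"
  assumes F: "F \<in> alg_auts"
  shows "Poly_Mapping.lookup p (Poly_Mapping.single m 1) =
    (\<Sum>l\<in>UNIV. Poly_Mapping.lookup (coeff (shift_coord F l p) 1) 0 *
       Poly_Mapping.lookup (F (Var l)) (Poly_Mapping.single m 1))"
  using adjoin_coords[OF F, of p]
proof induction
  case (const c)
  have "Poly_Mapping.single m (1::nat) \<noteq> 0"
    by (metis lookup_single_eq lookup_zero zero_neq_one)
  then show ?case
    by (simp add: alg_hom_TD(1)[OF alg_hom_T_shift_coord[OF F]]) (simp add: Const_def lookup_single when_def)
next
  case (gen p)
  then obtain j where p: "p = F (Var j)" by blast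
  have "(\<Sum>l\<in>UNIV. Poly_Mapping.lookup (coeff (shift_coord F l p) 1) 0 * h l) = h j" for h :: "'n \<Rightarrow> 'k"
  proof -
    have "(\<Sum>l\<in>UNIV. Poly_Mapping.lookup (coeff (shift_coord F l p) 1) 0 * h l) = (\<Sum>l\<in>UNIV. if l = j then h l else 0)"
      by (rule sum.cong) (auto simp: p shift_coord_coord[OF F] Const_def)
    then show ?thesis by simp
  qed
  then show ?case by (simp add: p)
next
  case (add p q)
  then show ?case
    by (simp add: lookup_add alg_hom_TD(2)[OF alg_hom_T_shift_coord[OF F]] distrib_right sum.distrib)
next
  case (mult p q)
  have "Poly_Mapping.lookup (coeff (shift_coord F l (p * q)) 1) 0 =
      Poly_Mapping.lookup p 0 * Poly_Mapping.lookup (coeff (shift_coord F l q) 1) 0 +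
      Poly_Mapping.lookup (coeff (shift_coord F l p) 1) 0 * Poly_Mapping.lookup q 0" for l
    by (simp add: alg_hom_TD(3)[OF alg_hom_T_shift_coord[OF F]] coeff_mult lookup_add lookup_mult_0
        coeff_0_shift_coord[OF F])
  then show ?case
    unfolding lookup_mult_single mult.IH
    by (simp add: sum.distrib sum_distrib_left sum_distrib_right algebra_simps)
qed

text \<open>
  The Jacobian matrix \<open>L\<close> of the \<open>f\<^sub>j\<close> at the origin has the inverse \<open>A\<close> formed by the \<open>\<partial>x\<^sub>i/\<partial>f\<^sub>l\<close>, so both
  determinants are nonzero. The resulting permutations pair each \<open>f\<^sub>j\<close> with a variable that occurs
  linearly in it, and each variable with a coordinate whose translation moves that variable.
\<close>

lemma aut_matchings:
  fixes F :: "('n::finite, 'k::idom) mpoly \<Rightarrow> ('n, 'k) mpoly"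
  assumes F: "F \<in> alg_auts"
  obtains \<pi> \<rho> where "\<pi> permutes UNIV" "\<And>j. Poly_Mapping.lookup (F (Var j)) (Poly_Mapping.single (\<pi> j) 1) \<noteq> 0"
    "\<rho> permutes UNIV" "\<And>i. degree (shift_coord F (\<rho> i) (Var i)) \<noteq> 0"
proof -
  define A :: "'k ^ 'n ^ 'n" where
    "A = (\<chi> i l. Poly_Mapping.lookup (coeff (shift_coord F l (Var i)) 1) 0)"
  define L :: "'k ^ 'n ^ 'n" where
    "L = (\<chi> l m. Poly_Mapping.lookup (F (Var l)) (Poly_Mapping.single m 1))"
  have single_inj: "Poly_Mapping.single i (1::nat) = Poly_Mapping.single m 1 \<longleftrightarrow> i = m" for i m :: 'n
    by (metis lookup_single_eq lookup_single_not_eq zero_neq_one)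
  have "A ** L = mat 1"
    unfolding vec_eq_iff
  proof (intro allI)
    fix i m
    have "(A ** L) $ i $ m = Poly_Mapping.lookup (Var i :: ('n, 'k) mpoly) (Poly_Mapping.single m 1)"
      unfolding chain_rule_at_origin[OF F, of "Var i"] by (simp add: A_def L_def matrix_matrix_mult_def)
    then show "(A ** L) $ i $ m = mat 1 $ i $ m"
      unfolding Var_def lookup_single when_def single_inj by (simp add: mat_def)
  qed
  then have "det A * det L = 1"
    by (metis det_I det_mul)
  then have nz: "det A \<noteq> 0" "det L \<noteq> 0" by auto
  obtain \<rho> where \<rho>: "\<rho> permutes UNIV" "\<And>i. A $ i $ \<rho> i \<noteq> 0"
    using det_nonzero_imp_matching[OF nz(1)] by blast
  obtain \<pi> where \<pi>: "\<pi> permutes UNIV" "\<And>i. L $ i $ \<pi> i \<noteq> 0"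
    using det_nonzero_imp_matching[OF nz(2)] by blast
  have "degree (shift_coord F (\<rho> i) (Var i)) \<noteq> 0" for i
  proof
    assume "degree (shift_coord F (\<rho> i) (Var i)) = 0"
    then have "coeff (shift_coord F (\<rho> i) (Var i)) 1 = 0"
      by (simp add: coeff_eq_0)
    then show False
      using \<rho>(2)[of i] by (simp add: A_def)
  qed
  with \<rho>(1) \<pi> show thesis
    by (intro that[of \<pi> \<rho>]) (simp_all add: L_def)
qed

lemma exists_variable_moved_by_shift:
  fixes u :: "'n::finite \<Rightarrow> 'h::linordered_ab_group_add"
    and F :: "('n, 'k::idom) mpoly \<Rightarrow> ('n, 'k) mpoly"
  assumes F: "F \<in> alg_auts" and j: "j \<in> I" "degree (shift_coord F l (Var j)) \<noteq> 0"
  obtains i where "i \<in> I"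
    "\<And>p a. p \<noteq> 0 \<Longrightarrow> p \<in> adjoin (Var ` I) \<Longrightarrow> shift_coord F l p = [:p, Const a:] \<Longrightarrow>
       Var i dvd init_form u p \<Longrightarrow> a \<noteq> 0 \<and> wdeg u p = Fin (u i)"
  by (rule exists_moved_variable[where u = u and y = "\<lambda>i. shift_coord F l (Var i)" and I = I and j = j])
    (use coeff_0_shift_coord[OF F] j in \<open>auto simp flip: shift_coord_eq_evalp[OF F]\<close>)

section \<open>Iterated initial forms\<close>

text \<open>
  The pair \<open>(w, v)\<close> as a single weight. The group \<open>nat \<Rightarrow>\<^sub>0 'g\<close>, whose order compares values at the
  smallest index where they differ, contains the lexicographic square of \<open>'g\<close> as the elements
  supported on \<open>{0, 1}\<close>.
\<close>

definition lex_weight ::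
  "('n \<Rightarrow> 'g::linordered_ab_group_add) \<Rightarrow> ('n \<Rightarrow> 'g) \<Rightarrow> 'n \<Rightarrow> nat \<Rightarrow>\<^sub>0 'g" where
  "lex_weight w v i = Poly_Mapping.single 0 (w i) + Poly_Mapping.single 1 (v i)"

lemma lex_eq_iff:
  "Poly_Mapping.single 0 a + Poly_Mapping.single 1 b = Poly_Mapping.single 0 c + Poly_Mapping.single (1::nat) d
     \<longleftrightarrow> a = c \<and> b = d" (is "?x = ?y \<longleftrightarrow> _")
  for a b c d :: "'g::linordered_ab_group_add"
proof
  assume eq: "?x = ?y"
  show "a = c \<and> b = d"
    using arg_cong[OF eq, of "\<lambda>x. Poly_Mapping.lookup x 0"] arg_cong[OF eq, of "\<lambda>x. Poly_Mapping.lookup x 1"]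
    by (simp add: lookup_add lookup_single)
qed simp

lemma lex_le_iff:
  "Poly_Mapping.single 0 a + Poly_Mapping.single 1 b \<le> Poly_Mapping.single 0 c + Poly_Mapping.single (1::nat) d
     \<longleftrightarrow> a < c \<or> a = c \<and> b \<le> d" (is "?x \<le> ?y \<longleftrightarrow> _")
  for a b c d :: "'g::linordered_ab_group_add"
proof -
  have x: "Poly_Mapping.lookup ?x k = (if k = 0 then a else if k = 1 then b else 0)" for k
    by (auto simp: lookup_add lookup_single when_def)
  have y: "Poly_Mapping.lookup ?y k = (if k = 0 then c else if k = 1 then d else 0)" for k
    by (auto simp: lookup_add lookup_single when_def)
  have "?x < ?y \<longleftrightarrow> a < c \<or> a = c \<and> b < d"
    unfolding less_poly_mapping.rep_eq less_fun_def
  proof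
    assume "\<exists>k. Poly_Mapping.lookup ?x k < Poly_Mapping.lookup ?y k \<and>
      (\<forall>k'<k. Poly_Mapping.lookup ?x k' = Poly_Mapping.lookup ?y k')"
    then show "a < c \<or> a = c \<and> b < d"
      unfolding x y by (auto split: if_splits)
  next
    assume "a < c \<or> a = c \<and> b < d"
    then show "\<exists>k. Poly_Mapping.lookup ?x k < Poly_Mapping.lookup ?y k \<and>
      (\<forall>k'<k. Poly_Mapping.lookup ?x k' = Poly_Mapping.lookup ?y k')"
    proof
      assume "a < c"
      then show ?thesis by (intro exI[of _ 0]) (simp add: x y del: One_nat_def)
    next
      assume "a = c \<and> b < d"
      then show ?thesis by (intro exI[of _ 1]) (simp add: lookup_add lookup_single when_def)
    qed
  qed
  then show ?thesis
    unfolding order.order_iff_strict lex_eq_iff by auto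
qed

lemma mon_weight_lex:
  fixes w v :: "'n::finite \<Rightarrow> 'g::linordered_ab_group_add"
  shows
  "mon_weight (lex_weight w v) m =
     Poly_Mapping.single 0 (mon_weight w m) + Poly_Mapping.single 1 (mon_weight v m)"
proof -
  have nm: "nmult a (Poly_Mapping.single l g) = Poly_Mapping.single l (nmult a g)" for a and l :: nat and g :: 'g
    by (induction a) (simp_all add: single_add)
  have sm: "(\<Sum>i\<in>A. Poly_Mapping.single l (h i)) = Poly_Mapping.single l (sum h A)"
    for A :: "'n set" and l :: nat and h :: "'n \<Rightarrow> 'g"
    by (induction A rule: infinite_finite_induct) (simp_all add: single_add)
  show ?thesis
    by (simp add: mon_weight_def lex_weight_def nmult_add_right nm sm sum.distrib)
qed

lemma init_form_lex:
  fixes p :: "('n::finite, 'k::comm_ring_1) mpoly"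
  assumes "p \<noteq> 0"
  shows "init_form v (init_form w p) = init_form (lex_weight w v) p"
    and "\<exists>\<gamma> \<delta>. wdeg w p = Fin \<gamma> \<and> wdeg (lex_weight w v) p = Fin (Poly_Mapping.single 0 \<gamma> + Poly_Mapping.single 1 \<delta>)"
proof -
  obtain \<gamma> where \<gamma>: "wbound w \<gamma> p" "wcomp w \<gamma> p \<noteq> 0"
    using obtain_top[OF assms] .
  obtain \<delta> where \<delta>: "wbound v \<delta> (wcomp w \<gamma> p)" "wcomp v \<delta> (wcomp w \<gamma> p) \<noteq> 0"
    using obtain_top[OF \<gamma>(2)] .
  let ?\<epsilon> = "Poly_Mapping.single 0 \<gamma> + Poly_Mapping.single 1 \<delta>"
  have comp: "wcomp (lex_weight w v) ?\<epsilon> p = wcomp v \<delta> (wcomp w \<gamma> p)"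
    by (rule poly_mapping_eqI) (auto simp only: lookup_wcomp mon_weight_lex lex_eq_iff split: if_splits)
  have bound: "wbound (lex_weight w v) ?\<epsilon> p"
    using \<gamma>(1) \<delta>(1) unfolding wbound_def mon_weight_lex lex_le_iff keys_wcomp by force
  have nz: "wcomp (lex_weight w v) ?\<epsilon> p \<noteq> 0"
    unfolding comp by (rule \<delta>(2))
  show "init_form v (init_form w p) = init_form (lex_weight w v) p"
    unfolding top_unique[OF \<gamma>] top_unique[OF \<delta>] top_unique[OF bound nz] comp ..
  show "\<exists>\<gamma> \<delta>. wdeg w p = Fin \<gamma> \<and> wdeg (lex_weight w v) p = Fin (Poly_Mapping.single 0 \<gamma> + Poly_Mapping.single 1 \<delta>)"
    using top_unique[OF \<gamma>] top_unique[OF bound nz] by blast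
qed

section \<open>Degrees and initial forms of the coordinates\<close>

lemma init_form_keys:
  assumes "m \<in> Poly_Mapping.keys (init_form w p)"
  shows "m \<in> Poly_Mapping.keys p" "wdeg w p = Fin (mon_weight w m)"
proof -
  from assms have "p \<noteq> 0" by (auto simp: init_form_def)
  then obtain \<gamma> where \<gamma>: "wbound w \<gamma> p" "wcomp w \<gamma> p \<noteq> 0"
    by (rule obtain_top)
  show "m \<in> Poly_Mapping.keys p" "wdeg w p = Fin (mon_weight w m)"
    using assms unfolding top_unique[OF \<gamma>] keys_wcomp by auto
qed

lemma Var_dvd_if_all_keys:
  fixes p :: "('n, 'k::comm_ring_1) mpoly"
  assumes "\<And>m. m \<in> Poly_Mapping.keys p \<Longrightarrow> Poly_Mapping.lookup m i \<noteq> 0"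
  shows "Var i dvd p"
proof -
  have "Var i dvd Poly_Mapping.single m c" if "Poly_Mapping.lookup m i \<noteq> 0" for m :: "'n \<Rightarrow>\<^sub>0 nat" and c :: 'k
  proof
    have "Poly_Mapping.single i 1 + (m - Poly_Mapping.single i 1) = m"
      using that by (intro poly_mapping_eqI) (auto simp: lookup_add lookup_minus lookup_single when_def)
    then show "Poly_Mapping.single m c = Var i * Poly_Mapping.single (m - Poly_Mapping.single i 1) c"
      unfolding Var_def mult_single by simp
  qed
  then have "Var i dvd (\<Sum>m\<in>Poly_Mapping.keys p. Poly_Mapping.single m (Poly_Mapping.lookup p m))"
    using assms by (intro dvd_sum) auto
  then show ?thesis unfolding sum_singles[symmetric] .
qed

text \<open>
  Membership in \<open>I\<^sub>0\<close> comes for free from non-divisibility: some monomial of \<open>(p\<^sup>w)\<^sup>v\<close> does not involve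
  \<open>x\<^sub>i\<close>, and it is a monomial of \<open>p\<close> of weight \<open>deg\<^sub>w p\<close>.
\<close>

lemma wdeg_in_nonneg_span:
  fixes p :: "('n::finite, 'k::comm_ring_1) mpoly"
  assumes p: "p \<in> adjoin (Var ` I)" and ndvd: "\<not> Var i dvd init_form v (init_form w p)"
  shows "wdeg w p \<in> Fin ` nonneg_span w (I - {i})"
proof -
  from ndvd obtain m where m: "m \<in> Poly_Mapping.keys (init_form v (init_form w p))" "Poly_Mapping.lookup m i = 0"
    using Var_dvd_if_all_keys[of "init_form v (init_form w p)" i] by blast
  have mw: "m \<in> Poly_Mapping.keys (init_form w p)"
    using m(1) by (rule init_form_keys)
  have "Poly_Mapping.keys m \<subseteq> I - {i}"
    using keys_adjoin_Var[OF p init_form_keys(1)[OF mw]] m(2) by (auto simp: in_keys_iff)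
  then have "Poly_Mapping.lookup m j = 0" if "j \<notin> I - {i}" for j
    using that by (simp add: subset_iff in_keys_iff) blast
  then have "mon_weight w m = (\<Sum>j\<in>I - {i}. nmult (Poly_Mapping.lookup m j) (w j))"
    unfolding mon_weight_def by (intro sum.mono_neutral_right) auto
  then show ?thesis
    unfolding init_form_keys(2)[OF mw] nonneg_span_def
    by (intro imageI CollectI exI[of _ "Poly_Mapping.lookup m"]) simp
qed

lemma init_form_dvd_init_form_prod:
  fixes g :: "'a \<Rightarrow> ('n::finite, 'k::idom) mpoly"
  assumes "finite A" "\<And>j. j \<in> A \<Longrightarrow> g j \<noteq> 0"
  shows "prod g A \<noteq> 0 \<and> (\<forall>j\<in>A. init_form u (g j) dvd init_form u (prod g A))"
  using assms
proof (induction A)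
  case (insert a A)
  then have "g a \<noteq> 0" "prod g A \<noteq> 0" by auto
  then have "init_form u (prod g (insert a A)) = init_form u (g a) * init_form u (prod g A)"
    using insert.hyps by (simp add: init_form_mult)
  then show ?case
    using insert.IH insert.prems mpoly_no_zero_divisors[OF \<open>g a \<noteq> 0\<close> \<open>prod g A \<noteq> 0\<close>] insert.hyps
    by (simp add: dvd_mult)
qed simp

lemma sum_Fin: "(\<Sum>j\<in>A. Fin (h j)) = Fin (sum h A)"
  by (induction A rule: infinite_finite_induct) (simp_all add: zero_extended_def)

theorem theorem1p1:
  fixes w :: "'n::finite \<Rightarrow> 'g::linordered_ab_group_add"
    and F :: "('n, 'k::idom) mpoly \<Rightarrow> ('n, 'k) mpoly"
    and f :: "'n \<Rightarrow> ('n, 'k) mpoly"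
    and I J I\<^sub>0 :: "'n set"
  assumes "F \<in> alg_auts"
    and "f = (\<lambda>j. F (Var j))"
    and "I \<noteq> {}"
    and "J = {j. f j \<in> adjoin (Var ` I)}"
    and "I\<^sub>0 = {i\<^sub>0 \<in> I. \<forall>j\<in>J. wdeg w (f j) \<in> Fin ` nonneg_span w (I - {i\<^sub>0})}"
  shows
    "((\<exists>\<sigma>. bij_betw \<sigma> J I \<and> (\<forall>j\<in>J. wdeg w (f j) = Fin (w (\<sigma> j))))
      \<or> (((\<Sum>j\<in>J. wdeg w (f j)) > Fin (\<Sum>i\<in>I. w i) \<or> card I > card J)
         \<and> (\<forall>v :: 'n \<Rightarrow> 'g. \<exists>i\<in>I\<^sub>0. \<forall>j\<in>J. \<not> Var i dvd init_form v (init_form w (f j)))))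
     \<and> (card I > card J \<longrightarrow>
         (\<forall>p \<in> adjoin (f ` J). p \<noteq> 0 \<longrightarrow>
           (\<forall>v :: 'n \<Rightarrow> 'g. \<exists>i\<in>I\<^sub>0. \<not> Var i dvd init_form v (init_form w p))))"
proof -
  note F = assms(1)
  have f: "f j = F (Var j)" for j
    using assms(2) by simp
  have fJ: "f j \<in> adjoin (Var ` I)" if "j \<in> J" for j
    using that assms(4) by simp
  have F0: "F 0 = 0"
    using alg_autsD(2)[OF F, of 0] by simp
  have nz: "f j \<noteq> 0" for j
  proof
    assume "f j = 0"
    then have "F (Var j) = F 0"
      by (simp add: f F0)
    then have "Var j = (0 :: ('n, 'k) mpoly)"
      using bij_is_inj[OF alg_autsD(1)[OF F]] by (simp add: inj_eq)
    then show False
      unfolding Var_def by (metis lookup_single_eq lookup_zero zero_neq_one)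
  qed
  have I0: "i \<in> I\<^sub>0" if "i \<in> I" "\<And>j. j \<in> J \<Longrightarrow> \<not> Var i dvd init_form v (init_form w (f j))" for i and v :: "'n \<Rightarrow> 'g"
    unfolding assms(5) using that(1) wdeg_in_nonneg_span[OF fJ that(2)] by simp
  obtain \<pi> \<rho> where \<pi>: "\<pi> permutes UNIV"
      "\<And>j. Poly_Mapping.lookup (F (Var j)) (Poly_Mapping.single (\<pi> j) 1) \<noteq> 0"
    and \<rho>: "\<rho> permutes UNIV" "\<And>i. degree (shift_coord F (\<rho> i) (Var i)) \<noteq> 0"
    using aut_matchings[OF F] by blast
  note \<pi> = \<pi>[folded f]
  \<comment> \<open>As \<open>\<pi> j\<close> is a variable of \<open>f j\<close>, the permutation \<open>\<pi>\<close> embeds \<open>J\<close> into \<open>I\<close>.\<close>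
  have \<pi>I: "\<pi> j \<in> I" if "j \<in> J" for j
    using keys_adjoin_Var[OF fJ[OF that], of "Poly_Mapping.single (\<pi> j) 1"] \<pi>(2)[of j]
    by (auto simp: in_keys_iff)
  have \<pi>_inj: "inj_on \<pi> J"
    using permutes_inj_on[OF \<pi>(1)] .
  have card_le: "card J \<le> card I"
    using \<pi>I by (intro card_inj_on_le[OF \<pi>_inj]) auto
  have ii: "\<exists>i\<in>I\<^sub>0. \<not> Var i dvd init_form v (init_form w p) \<and>
      (\<forall>j\<in>J. \<not> Var i dvd init_form v (init_form w (f j)))"
    if card: "card I > card J" and p: "p \<in> adjoin (f ` J)" "p \<noteq> 0" for p and v :: "'n \<Rightarrow> 'g"
  proof -
    \<comment> \<open>Since \<open>I\<close> is too large to be embedded into \<open>J\<close>, some translation of a coordinate outside \<open>J\<close> moves a variable in \<open>I\<close>.\<close>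
    have "\<not> \<rho> ` I \<subseteq> J"
      using card card_mono[of J "\<rho> ` I"] card_image[OF permutes_inj_on[OF \<rho>(1)]] by fastforce
    then obtain i\<^sub>1 where i1: "i\<^sub>1 \<in> I" "\<rho> i\<^sub>1 \<notin> J"
      by blast
    let ?l = "\<rho> i\<^sub>1" and ?u = "lex_weight w v"
    obtain i where i: "i \<in> I"
      "\<And>q a. q \<noteq> 0 \<Longrightarrow> q \<in> adjoin (Var ` I) \<Longrightarrow> shift_coord F ?l q = [:q, Const a:] \<Longrightarrow>
         Var i dvd init_form ?u q \<Longrightarrow> a \<noteq> 0 \<and> wdeg ?u q = Fin (?u i)"
      using exists_variable_moved_by_shift[where u = ?u, OF F i1(1) \<rho>(2)] by blast
    \<comment> \<open>The product lets one index \<open>i\<close> serve for \<open>p\<close> and all \<open>f j\<close> at once, as initial forms are multiplicative.\<close>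
    define q where "q = p * prod f J"
    have prodf: "prod f J \<noteq> 0" "\<And>j. j \<in> J \<Longrightarrow> init_form ?u (f j) dvd init_form ?u (prod f J)"
      using init_form_dvd_init_form_prod[of J f ?u] nz by auto
    have "q \<noteq> 0"
      using p(2) prodf(1) by (simp add: q_def mpoly_no_zero_divisors)
    have q_top: "init_form ?u q = init_form ?u p * init_form ?u (prod f J)"
      unfolding q_def by (rule init_form_mult[OF p(2) prodf(1)])
    have q: "q \<in> adjoin (f ` J)"
      unfolding q_def by (intro adjoin.mult p adjoin_prod adjoin.gen imageI)
    have "shift_coord F ?l q = [:q:]"
      by (rule alg_hom_T_eq_on_adjoin[OF alg_hom_T_shift_coord[OF F] alg_hom_T_inclusion _ q])
        (use i1(2) in \<open>auto simp: f shift_coord_coord[OF F]\<close>)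
    moreover have "q \<in> adjoin (Var ` I)"
      using q by induction (use fJ in \<open>auto intro: adjoin.intros\<close>)
    ultimately have "\<not> Var i dvd init_form ?u q"
      using i(2)[of q 0] \<open>q \<noteq> 0\<close> by auto
    then have ndvd: "\<not> Var i dvd init_form ?u p" "\<not> Var i dvd init_form ?u (prod f J)"
      unfolding q_top by auto
    have "\<not> Var i dvd init_form v (init_form w (f j))" if "j \<in> J" for j
      using ndvd(2) dvd_trans[OF _ prodf(2)[OF that]] unfolding init_form_lex(1)[OF nz] by blast
    then show ?thesis
      using I0[OF i(1), of v] ndvd(1) unfolding init_form_lex(1)[OF p(2)] by blast
  qed
  have i: "(\<Sum>j\<in>J. wdeg w (f j)) > Fin (\<Sum>i\<in>I. w i)
         \<and> (\<forall>v :: 'n \<Rightarrow> 'g. \<exists>i\<in>I\<^sub>0. \<forall>j\<in>J. \<not> Var i dvd init_form v (init_form w (f j)))"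
    if card: "card I = card J"
      and no_bij: "\<nexists>\<sigma>. bij_betw \<sigma> J I \<and> (\<forall>j\<in>J. wdeg w (f j) = Fin (w (\<sigma> j)))"
  proof -
    have bij: "bij_betw \<sigma> J I" if "inj_on \<sigma> J" "\<sigma> ` J \<subseteq> I" for \<sigma>
      using that card card_image[OF that(1)] card_subset_eq[OF _ that(2)] by (simp add: bij_betw_def)
    have "bij_betw \<pi> J I"
      using \<pi>_inj \<pi>I by (intro bij) auto
    have "\<forall>j. \<exists>\<gamma>. wbound w \<gamma> (f j) \<and> wcomp w \<gamma> (f j) \<noteq> 0"
      using obtain_top[OF nz] by blast
    then obtain \<gamma> where \<gamma>: "\<And>j. wbound w (\<gamma> j) (f j)" "\<And>j. wcomp w (\<gamma> j) (f j) \<noteq> 0"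
      by metis
    have deg: "wdeg w (f j) = Fin (\<gamma> j)" for j
      using top_unique[OF \<gamma>] by simp
    \<comment> \<open>The variable \<open>\<pi> j\<close> itself is a monomial of \<open>f j\<close>.\<close>
    have le: "w (\<pi> j) \<le> \<gamma> j" for j
      using \<gamma>(1)[of j] \<pi>(2)[of j] by (force simp: wbound_def in_keys_iff)
    have "\<exists>j\<in>J. w (\<pi> j) \<noteq> \<gamma> j"
    proof (rule ccontr)
      assume "\<not> ?thesis"
      then have "\<forall>j\<in>J. wdeg w (f j) = Fin (w (\<pi> j))"
        by (simp add: deg)
      then show False
        using no_bij \<open>bij_betw \<pi> J I\<close> by blast
    qed
    then have "(\<Sum>j\<in>J. w (\<pi> j)) < (\<Sum>j\<in>J. \<gamma> j)"
      using le by (intro sum_strict_mono_ex1) (auto simp: order_less_le)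
    moreover have "(\<Sum>j\<in>J. w (\<pi> j)) = (\<Sum>i\<in>I. w i)"
      using sum.reindex_bij_betw[OF \<open>bij_betw \<pi> J I\<close>] .
    ultimately have "Fin (\<Sum>i\<in>I. w i) < (\<Sum>j\<in>J. wdeg w (f j))"
      by (simp add: deg sum_Fin)
    moreover have "\<exists>i\<in>I\<^sub>0. \<forall>j\<in>J. \<not> Var i dvd init_form v (init_form w (f j))" for v :: "'n \<Rightarrow> 'g"
    proof (rule ccontr)
      let ?u = "lex_weight w v"
      assume "\<not> ?thesis"
      then have cover: "\<exists>j\<in>J. Var i dvd init_form ?u (f j)" if "i \<in> I" for i
        using I0[OF that, of v] unfolding init_form_lex(1)[OF nz] by blast
      have "\<exists>i\<in>I. wdeg w (f l) = Fin (w i) \<and> (\<forall>j\<in>J. j \<noteq> l \<longrightarrow> \<not> Var i dvd init_form ?u (f j)) \<and>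
          Var i dvd init_form ?u (f l)" if l: "l \<in> J" for l
      proof -
        \<comment> \<open>A homomorphism fixing all variables in \<open>I\<close> would fix \<open>f l\<close>.\<close>
        have "\<exists>j\<in>I. degree (shift_coord F l (Var j)) \<noteq> 0"
        proof (rule ccontr)
          assume "\<not> ?thesis"
          then have "shift_coord F l (Var j) = [:Var j:]" if "j \<in> I" for j
            using coeff_0_shift_coord[OF F, of l "Var j"] that by (metis degree_eq_zeroE coeff_pCons_0)
          then have "shift_coord F l (f l) = [:f l:]"
            by (intro alg_hom_T_eq_on_adjoin[OF alg_hom_T_shift_coord[OF F] alg_hom_T_inclusion _ fJ[OF l]]) auto
          then show False
            by (simp add: f shift_coord_coord[OF F])
        qed
        then obtain j\<^sub>1 where j1: "j\<^sub>1 \<in> I" "degree (shift_coord F l (Var j\<^sub>1)) \<noteq> 0" by blast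
        obtain i where i: "i \<in> I"
          "\<And>q a. q \<noteq> 0 \<Longrightarrow> q \<in> adjoin (Var ` I) \<Longrightarrow> shift_coord F l q = [:q, Const a:] \<Longrightarrow>
             Var i dvd init_form ?u q \<Longrightarrow> a \<noteq> 0 \<and> wdeg ?u q = Fin (?u i)"
          using exists_variable_moved_by_shift[where u = ?u, OF F j1] by blast
        \<comment> \<open>By the choice of \<open>i\<close>, it divides no initial form of a fixed coordinate; being covered, it divides that of \<open>f l\<close>.\<close>
        have moved: "j = l \<and> wdeg ?u (f j) = Fin (?u i)" if "j \<in> J" "Var i dvd init_form ?u (f j)" for j
        proof -
          have "shift_coord F l (f j) = [:f j, Const (if j = l then 1 else 0):]"
            by (simp only: f shift_coord_coord[OF F])
          from i(2)[OF nz fJ[OF that(1)] this that(2)] show ?thesis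
            by (auto split: if_splits)
        qed
        obtain j where j: "j \<in> J" "Var i dvd init_form ?u (f j)"
          using cover[OF i(1)] by blast
        have jl: "j = l" "wdeg ?u (f l) = Fin (?u i)"
          using moved[OF j] by auto
        have "wdeg w (f l) = Fin (w i)"
          using init_form_lex(2)[OF nz[of l], of w v] jl(2) by (auto simp: lex_weight_def lex_eq_iff simp del: One_nat_def)
        then show ?thesis
          using i(1) moved j jl(1) by blast
      qed
      then obtain \<sigma> where \<sigma>: "\<And>l. l \<in> J \<Longrightarrow> \<sigma> l \<in> I" "\<And>l. l \<in> J \<Longrightarrow> wdeg w (f l) = Fin (w (\<sigma> l))"
        "\<And>l j. l \<in> J \<Longrightarrow> j \<in> J \<Longrightarrow> j \<noteq> l \<Longrightarrow> \<not> Var (\<sigma> l) dvd init_form ?u (f j)"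
        "\<And>l. l \<in> J \<Longrightarrow> Var (\<sigma> l) dvd init_form ?u (f l)"
        by metis
      have "inj_on \<sigma> J"
        using \<sigma>(3,4) by (metis inj_onI)
      then have "bij_betw \<sigma> J I"
        using \<sigma>(1) by (intro bij) auto
      then show False
        using no_bij \<sigma>(2) by blast
    qed
    ultimately show "(\<Sum>j\<in>J. wdeg w (f j)) > Fin (\<Sum>i\<in>I. w i)
         \<and> (\<forall>v :: 'n \<Rightarrow> 'g. \<exists>i\<in>I\<^sub>0. \<forall>j\<in>J. \<not> Var i dvd init_form v (init_form w (f j)))"
      by blast
  qed
  show ?thesis
  proof (cases "card I = card J")
    case True
    then have "\<not> card I > card J" by simp
    then show ?thesis
      using i[OF True] by blast
  next
    case False
    then have card: "card I > card J"
      using card_le by simp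
    have one: "(1 :: ('n, 'k) mpoly) \<in> adjoin (f ` J)"
      using adjoin.const[of 1 "f ` J"] by simp
    have "\<exists>i\<in>I\<^sub>0. \<forall>j\<in>J. \<not> Var i dvd init_form v (init_form w (f j))" for v :: "'n \<Rightarrow> 'g"
      using ii[OF card one one_neq_zero, of v] by blast
    moreover have "\<exists>i\<in>I\<^sub>0. \<not> Var i dvd init_form v (init_form w p)"
      if "p \<in> adjoin (f ` J)" "p \<noteq> 0" for p and v :: "'n \<Rightarrow> 'g"
      using ii[OF card that, of v] by blast
    ultimately show ?thesis
      using card by blast
  qed
qed

end
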